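(* Let $d\ge 3$ be an integer. Local Search is a polynomial time $\left(\frac{3}{4}d-\frac{1}{8}+\frac{3}{16d-8}\right)$-factor approximation algorithm for the maximum induced matching problem in $d$-regular $C_5$-free graphs; that is, it runs in polynomial time, and for every $d$-regular $C_5$-free graph $G$, every induced matching $M$ produced by applying Local Search to $G$ satisfies $\nu_s(G)\leq\left(\frac{3}{4}d-\frac{1}{8}+\frac{3}{16d-8}\right)|M|$.
   Context: Graphs are finite, simple, and undirected; $E(G)$ is the edge set of $G$. A graph is $d$-regular if all its vertices have degree $d$. $C_5$ is the cycle of order $5$; $G$ is $C_5$-free if it contains no $C_5$ as an induced subgraph. A set $M\subseteq E(G)$ is an induced matching of $G$ if the subgraph of $G$ induced by the set of vertices incident with edges in $M$ is $1$-regular (the empty set is an induced matching). $\nu_s(G)$ is the maximum number of edges of an induced matching of $G$; the maximum induced matching problem asks for an induced matching of this size. Local Search is the following algorithm on input $G$: start with $M=\emptyset$ and repeat the following iteration: (1) if $M\cup\{e\}$ is an induced matching of $G$ for some edge $e\in E(G)\setminus M$, replace $M$ by $M\cup\{e\}$; (2) if $(M\setminus\{e\})\cup\{e',e''\}$ is an induced matching of $G$ for some three distinct edges $e\in M$ and $e',e''\in E(G)\setminus M$, replace $M$ by $(M\setminus\{e\})\cup\{e',e''\}$. The choices are arbitrary. Stop when $|M|$ does not increase during one iteration (i.e. neither (1) nor (2) is possible), and return $M$. *)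

theory Defs
  imports Complex_Main "HOL-Computational_Algebra.Polynomial"
begin

section \<open>Graphs and induced matchings\<close>

definition fin_graph :: "'a set \<Rightarrow> 'a set set \<Rightarrow> bool" where
  "fin_graph V E \<longleftrightarrow> finite V \<and> (\<forall>e\<in>E. e \<subseteq> V \<and> card e = 2)"

definition degree :: "'a set set \<Rightarrow> 'a \<Rightarrow> nat" where
  "degree E v = card {e \<in> E. v \<in> e}"

definition regular :: "nat \<Rightarrow> 'a set \<Rightarrow> 'a set set \<Rightarrow> bool" where
  "regular d V E \<longleftrightarrow> (\<forall>v\<in>V. degree E v = d)"

definition induced_edges :: "'a set set \<Rightarrow> 'a set \<Rightarrow> 'a set set" where
  "induced_edges E S = {e \<in> E. e \<subseteq> S}"

definition isomorphic :: "'a set \<Rightarrow> 'a set set \<Rightarrow> 'b set \<Rightarrow> 'b set set \<Rightarrow> bool" where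
  "isomorphic V E W F \<longleftrightarrow>
    (\<exists>f. bij_betw f V W \<and> (\<forall>u\<in>V. \<forall>v\<in>V. {u, v} \<in> E \<longleftrightarrow> {f u, f v} \<in> F))"

definition cycle_edges :: "nat \<Rightarrow> nat set set" where
  "cycle_edges n = {{i, (i + 1) mod n} | i. i < n}"

definition C5_free :: "'a set \<Rightarrow> 'a set set \<Rightarrow> bool" where
  "C5_free V E \<longleftrightarrow>
    \<not> (\<exists>S\<subseteq>V. isomorphic S (induced_edges E S) {..<5} (cycle_edges 5))"

definition induced_matching :: "'a set set \<Rightarrow> 'a set set \<Rightarrow> bool" where
  "induced_matching E M \<longleftrightarrow> M \<subseteq> E \<and> regular 1 (\<Union>M) (induced_edges E (\<Union>M))"

definition nu_s :: "'a set set \<Rightarrow> nat" where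
  "nu_s E = Max (card ` {M. induced_matching E M})"


section \<open>Local Search\<close>

definition add_move :: "'a set set \<Rightarrow> 'a set set \<Rightarrow> 'a set set \<Rightarrow> bool" where
  "add_move E M M' \<longleftrightarrow> (\<exists>e \<in> E - M. M' = M \<union> {e} \<and> induced_matching E M')"

definition swap_move :: "'a set set \<Rightarrow> 'a set set \<Rightarrow> 'a set set \<Rightarrow> bool" where
  "swap_move E M M' \<longleftrightarrow>
    (\<exists>e \<in> M. \<exists>e' \<in> E - M. \<exists>e'' \<in> E - M.
       e' \<noteq> e'' \<and> M' = (M - {e}) \<union> {e', e''} \<and> induced_matching E M')"

definition if_possible :: "('s \<Rightarrow> 's \<Rightarrow> bool) \<Rightarrow> 's \<Rightarrow> 's \<Rightarrow> bool" where
  "if_possible R x y \<longleftrightarrow> (if \<exists>z. R x z then R x y else y = x)"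

definition iteration :: "'a set set \<Rightarrow> 'a set set \<Rightarrow> 'a set set \<Rightarrow> bool" where
  "iteration E = if_possible (add_move E) OO if_possible (swap_move E)"

text \<open>
  \<^term>\<open>local_search_run E M Ms\<close>: started with the current matching \<^term>\<open>M\<close>,
  Local Search can perform exactly \<^term>\<open>length Ms\<close> further iterations before it stops,
  and \<^term>\<open>Ms\<close> lists the current matching after each of them. The last iteration is the
  one in which the size of the matching does not increase.
\<close>

inductive local_search_run :: "'a set set \<Rightarrow> 'a set set \<Rightarrow> 'a set set list \<Rightarrow> bool" for E where
  stop: "iteration E M M' \<Longrightarrow> \<not> card M < card M' \<Longrightarrow> local_search_run E M [M']"
| continue: "iteration E M M' \<Longrightarrow> card M < card M' \<Longrightarrow> local_search_run E M' Ms \<Longrightarrow>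
    local_search_run E M (M' # Ms)"

definition local_search_output :: "'a set set \<Rightarrow> 'a set set \<Rightarrow> bool" where
  "local_search_output E M \<longleftrightarrow> (\<exists>Ms. local_search_run E {} Ms \<and> M = last Ms)"


section \<open>A random access machine model of running time\<close>

text \<open>
  A while language over registers and arrays holding natural numbers, with unit cost per
  executed instruction. Expressions are evaluated within one instruction; their size is a
  constant of the program. The only arithmetic operations are addition and (truncated)
  subtraction, so that numbers grow by at most a constant number of bits per step and
  polynomially many steps can be simulated by a Turing machine in polynomial time.

  The instruction \<open>Choose x a\<close> assigns to \<open>x\<close> an arbitrary number that is at most the
  value of \<open>a\<close>. It renders the arbitrary choices of a nondeterministic algorithm. It is not a
  guess in the sense of nondeterministic complexity classes, since the statements below about
  a program always concern all of its executions.
\<close>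

datatype aexp =
    Num nat
  | Reg string
  | Read string aexp
  | Plus aexp aexp
  | Minus aexp aexp

datatype bexp =
    Less aexp aexp
  | Not bexp
  | And bexp bexp

datatype com =
    Skip
  | Assign string aexp
  | Write string aexp aexp
  | Choose string aexp
  | Seq com com
  | If bexp com com
  | While bexp com

record state =
  reg :: "string \<Rightarrow> nat"
  arr :: "string \<Rightarrow> nat \<Rightarrow> nat"

fun aval :: "aexp \<Rightarrow> state \<Rightarrow> nat" where
  "aval (Num k) s = k"
| "aval (Reg x) s = reg s x"
| "aval (Read A a) s = arr s A (aval a s)"
| "aval (Plus a b) s = aval a s + aval b s"
| "aval (Minus a b) s = aval a s - aval b s"

fun bval :: "bexp \<Rightarrow> state \<Rightarrow> bool" where
  "bval (Less a b) s \<longleftrightarrow> aval a s < aval b s"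
| "bval (Not b) s \<longleftrightarrow> \<not> bval b s"
| "bval (And b c) s \<longleftrightarrow> bval b s \<and> bval c s"

definition set_reg :: "string \<Rightarrow> nat \<Rightarrow> state \<Rightarrow> state" where
  "set_reg x k s = s\<lparr>reg := (reg s)(x := k)\<rparr>"

definition set_arr :: "string \<Rightarrow> nat \<Rightarrow> nat \<Rightarrow> state \<Rightarrow> state" where
  "set_arr A i k s = s\<lparr>arr := (arr s)(A := (arr s A)(i := k))\<rparr>"

inductive step :: "com \<times> state \<Rightarrow> com \<times> state \<Rightarrow> bool" where
  Assign: "step (Assign x a, s) (Skip, set_reg x (aval a s) s)"
| Write: "step (Write A a b, s) (Skip, set_arr A (aval a s) (aval b s) s)"
| Choose: "k \<le> aval a s \<Longrightarrow> step (Choose x a, s) (Skip, set_reg x k s)"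
| SeqSkip: "step (Seq Skip c, s) (c, s)"
| SeqStep: "step (c, s) (c', s') \<Longrightarrow> step (Seq c c2, s) (Seq c' c2, s')"
| IfTrue: "bval b s \<Longrightarrow> step (If b c1 c2, s) (c1, s)"
| IfFalse: "\<not> bval b s \<Longrightarrow> step (If b c1 c2, s) (c2, s)"
| WhileTrue: "bval b s \<Longrightarrow> step (While b c, s) (Seq c (While b c), s)"
| WhileFalse: "\<not> bval b s \<Longrightarrow> step (While b c, s) (Skip, s)"

text \<open>
  The only configurations without a successor are those with program \<open>Skip\<close>. Hence a bound
  on the length of all step sequences implies that every execution terminates.
\<close>

lemma step_exists: "c \<noteq> Skip \<Longrightarrow> \<exists>cfg. step (c, s) cfg"
proof (induction c)
  case (Seq c1 c2)
  show ?case
  proof (cases "c1 = Skip")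
    case True
    then show ?thesis by (auto intro: step.SeqSkip)
  next
    case False
    with Seq.IH obtain cfg where "step (c1, s) cfg" by blast
    then show ?thesis by (cases cfg) (auto intro: step.SeqStep)
  qed
next
  case (If b c1 c2)
  show ?case by (cases "bval b s") (auto intro: step.IfTrue step.IfFalse)
next
  case (While b c)
  show ?case by (cases "bval b s") (auto intro: step.WhileTrue step.WhileFalse)
qed (auto intro: step.intros)

lemma Skip_final: "\<not> step (Skip, s) cfg"
  by (auto elim: step.cases)

definition runs_within :: "com \<Rightarrow> state \<Rightarrow> nat \<Rightarrow> bool" where
  "runs_within c s t \<longleftrightarrow> (\<forall>k cfg. (step ^^ k) (c, s) cfg \<longrightarrow> k \<le> t)"

definition final_states :: "com \<Rightarrow> state \<Rightarrow> state set" where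
  "final_states c s = {s'. step\<^sup>*\<^sup>* (c, s) (Skip, s')}"


section \<open>Encoding of graphs and runs of Local Search\<close>

fun edge_of :: "nat \<times> nat \<Rightarrow> nat set" where
  "edge_of (u, v) = {u, v}"

text \<open>An input graph has vertex set \<^term>\<open>{..<n}\<close> and is given by a list of its edges.\<close>

definition edges_of :: "(nat \<times> nat) list \<Rightarrow> nat set set" where
  "edges_of es = edge_of ` set es"

definition graph_input :: "nat \<Rightarrow> (nat \<times> nat) list \<Rightarrow> bool" where
  "graph_input n es \<longleftrightarrow> fin_graph {..<n} (edges_of es) \<and> distinct (map edge_of es)"

text \<open>
  Initially, the register \<open>n\<close> holds the number of vertices, \<open>m\<close> the number of edges, and the
  arrays \<open>U\<close> and \<open>V\<close> hold the ends of the edges. Everything else is \<open>0\<close>.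
\<close>

definition input_state :: "nat \<Rightarrow> (nat \<times> nat) list \<Rightarrow> state" where
  "input_state n es =
    \<lparr>reg = (\<lambda>x. 0)(''n'' := n, ''m'' := length es),
     arr = (\<lambda>A i. 0)
       (''U'' := (\<lambda>i. if i < length es then fst (es ! i) else 0),
        ''V'' := (\<lambda>i. if i < length es then snd (es ! i) else 0))\<rparr>"

text \<open>
  Finally, the register \<open>k\<close> holds the number of iterations, and the array \<open>M\<close> consists of
  \<open>k\<close> consecutive rows of length \<^term>\<open>length es\<close>, whose nonzero entries indicate the
  edges in the matching after the respective iteration.
\<close>

definition output_run :: "(nat \<times> nat) list \<Rightarrow> state \<Rightarrow> nat set set list" where
  "output_run es s =
    map (\<lambda>t. {edge_of (es ! j) | j. j < length es \<and> arr s ''M'' (t * length es + j) \<noteq> 0})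
      [0..<reg s ''k'']"

text \<open>
  Local Search runs in polynomial time: some program, whose possible executions produce
  exactly the runs of Local Search, iteration by iteration, always halts within a number of
  steps that is polynomial in the size of the input graph.
\<close>

definition local_search_polynomial_time :: bool where
  "local_search_polynomial_time \<longleftrightarrow>
    (\<exists>(c :: com) (p :: nat poly). \<forall>n es. graph_input n es \<longrightarrow>
       runs_within c (input_state n es) (poly p (n + length es)) \<and>
       output_run es ` final_states c (input_state n es) =
         {Ms. local_search_run (edges_of es) {} Ms})"

end

theory Submission
  imports Defs
begin

text \<open>
  The statement has two independent halves.

  \<^bold>\<open>Approximation ratio.\<close> Call two edges linked if they share a vertex or are joined by an edge;
  an induced matching is a set of pairwise unlinked edges. In a \<open>d\<close>-regular graph an edge meets
  \<open>2d - 1\<close> edges, itself included, and no edge meets two members of an induced matching. Hence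
  \<open>\<nu>\<^sub>s(G) (2d - 1) \<le> |E|\<close> (\<open>induced_matching_card_le\<close>), and it remains to bound \<open>|E|\<close> in terms of \<open>|M|\<close>
  for a matching \<open>M\<close> at which Local Search stops. Since no edge can be added, every edge is linked
  to a member of \<open>M\<close>. Call an edge private to \<open>e \<in> M\<close> if \<open>e\<close> is the only member it is linked to. Counting an
  edge once for every member it is linked to and once more if it is private counts every edge at least
  twice, so \<open>2|E|\<close> is at most the sum over \<open>e \<in> M\<close> of the number of edges linked to \<open>e\<close> plus the
  number of edges private to \<open>e\<close> (\<open>twice_card_edges_le\<close>). By \<open>conflicts_privates_le\<close>, each summand
  is at most \<open>3d\<^sup>2 - 2d + 1\<close>, and \<open>(3d\<^sup>2 - 2d + 1) / (2(2d - 1))\<close> is the claimed ratio.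

  For that bound, let \<open>e = uv\<close>. Generic values are \<open>2d\<^sup>2 - 2d + 1\<close> for the edges linked to \<open>e\<close> and
  \<open>d\<^sup>2\<close> for the private ones. Common neighbours of \<open>u\<close> and \<open>v\<close>, and edges among the neighbours, can
  add private edges, but they lower the number of linked edges by at least as much. Everything else
  rests on one observation (\<open>private_path_complete\<close>). Let \<open>a\<close> be adjacent to \<open>u\<close> but not to \<open>v\<close>, let
  \<open>b\<close> be adjacent to \<open>v\<close> but not to \<open>u\<close>, let \<open>z\<close> be a vertex at distance two from \<open>e\<close>, and suppose that \<open>az\<close> and \<open>vb\<close> are private. As \<open>e\<close>
  cannot be swapped for \<open>az\<close> and \<open>vb\<close>, these two are linked, so \<open>ab\<close> or \<open>zb\<close> is an edge; in the second
  case \<open>ab\<close> is an edge as well, since otherwise \<open>u, a, z, b, v\<close> is an induced five-cycle. So a vertex on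
  one side of \<open>e\<close> that has private edges leading away from \<open>e\<close> is adjacent to every such \<open>b\<close> on the other
  side, and the degree spent there is lost for edges leading away.

  \<^bold>\<open>Running time.\<close> An explicit program is given whose executions are exactly the runs of Local Search.
  Every move replaces \<open>M\<close> by \<open>M - {a} \<union> {b, c}\<close> for some edges \<open>a, b, c\<close> (an addition has \<open>a = b = c\<close>), so
  both steps of an iteration are instances of one search through all triples. The program first chooses
  an arbitrary triple and then scans all triples deterministically; it performs the move given by the chosen
  triple if that is a legal move, and otherwise some legal move if there is one. In this way
  every legal move is the result of some choice, no execution gets stuck, and all reasoning about the
  scan is about deterministic code. The judgement \<open>computes\<close> bounds the time of a program
  and determines its set of outcomes at once; \<open>loop_correct\<close> is where the executions of the main loop
  are matched with the runs of Local Search.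
\<close>

section \<open>Edges and induced matchings\<close>

text \<open>
  The edge \<open>l\<close> may be \<open>e\<close> or \<open>f\<close>, so edges that share a vertex are linked.
\<close>
definition linked :: "'a set set \<Rightarrow> 'a set \<Rightarrow> 'a set \<Rightarrow> bool" where
  "linked E e f \<longleftrightarrow> (\<exists>l\<in>E. l \<inter> e \<noteq> {} \<and> l \<inter> f \<noteq> {})"

lemma linked_commute: "linked E e f \<longleftrightarrow> linked E f e"
  unfolding linked_def by blast

lemma fin_graph_edgeE:
  assumes "fin_graph V E" "e \<in> E"
  obtains x y where "e = {x, y}" "x \<noteq> y" "x \<in> V" "y \<in> V"
  using assms unfolding fin_graph_def card_2_iff by (metis insert_subset)

lemma fin_graph_edge_at:
  assumes "fin_graph V E" "e \<in> E" "x \<in> e"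
  obtains y where "e = {x, y}" "x \<noteq> y"
  using fin_graph_edgeE[OF assms(1,2)] assms(3) by (metis empty_iff insert_commute insert_iff)

lemma fin_graph_finite: "fin_graph V E \<Longrightarrow> finite E"
  unfolding fin_graph_def by (meson PowI finite_Pow_iff finite_subset subsetI)

lemma fin_graph_edge_neq: "fin_graph V E \<Longrightarrow> {x, y} \<in> E \<Longrightarrow> x \<noteq> y"
  unfolding fin_graph_def by fastforce

lemma fin_graph_edge_nonempty: "fin_graph V E \<Longrightarrow> e \<in> E \<Longrightarrow> e \<noteq> {}"
  unfolding fin_graph_def by fastforce

lemma linked_self: "fin_graph V E \<Longrightarrow> e \<in> E \<Longrightarrow> linked E e e"
  unfolding linked_def using fin_graph_edge_nonempty by fastforce

lemma linkedI_common: "e \<in> E \<Longrightarrow> x \<in> e \<Longrightarrow> x \<in> f \<Longrightarrow> linked E e f"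
  unfolding linked_def by blast

text \<open>
  An edge spanned by the vertices covered by \<open>M\<close>, other than a member of \<open>M\<close>, links the members that
  cover its ends; conversely, a link between two members gives one of its ends a second spanned edge.
\<close>
lemma induced_matching_iff_unlinked:
  assumes g: "fin_graph V E"
  shows "induced_matching E M \<longleftrightarrow> M \<subseteq> E \<and> (\<forall>e\<in>M. \<forall>f\<in>M. e \<noteq> f \<longrightarrow> \<not> linked E e f)"
proof (intro iffI conjI)
  assume im: "induced_matching E M"
  then show "M \<subseteq> E" unfolding induced_matching_def by blast
  have unique: "l = k"
    if "l \<in> E" "k \<in> E" "x \<in> l" "x \<in> k" "l \<subseteq> \<Union>M" "k \<subseteq> \<Union>M" for l k x
  proof -
    have "card {e \<in> induced_edges E (\<Union>M). x \<in> e} = 1"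
      using im that unfolding induced_matching_def regular_def degree_def by blast
    then obtain k' where "{e \<in> induced_edges E (\<Union>M). x \<in> e} = {k'}"
      by (rule card_1_singletonE)
    moreover have "l \<in> {e \<in> induced_edges E (\<Union>M). x \<in> e}"
      "k \<in> {e \<in> induced_edges E (\<Union>M). x \<in> e}"
      using that unfolding induced_edges_def by auto
    ultimately show ?thesis by simp
  qed
  show "\<forall>e\<in>M. \<forall>f\<in>M. e \<noteq> f \<longrightarrow> \<not> linked E e f"
  proof (intro ballI impI notI)
    fix e f assume ef: "e \<in> M" "f \<in> M" "e \<noteq> f" and "linked E e f"
    then obtain l x y where l: "l \<in> E" "x \<in> l" "x \<in> e" "y \<in> l" "y \<in> f"
      unfolding linked_def by blast
    have sub: "e \<subseteq> \<Union>M" "f \<subseteq> \<Union>M" "e \<in> E" "f \<in> E" using ef \<open>M \<subseteq> E\<close> by auto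
    show False
    proof (cases "x = y")
      case True
      then show False using unique[OF sub(3,4) l(3)] l sub ef by simp
    next
      case False
      moreover obtain z where "l = {x, z}" using fin_graph_edge_at[OF g l(1,2)] .
      ultimately have "l = {x, y}" using l by auto
      then have "l \<subseteq> \<Union>M" using l ef by auto
      then show False
        using unique[OF l(1) sub(3) l(2,3)] unique[OF l(1) sub(4) l(4,5)] sub ef by simp
    qed
  qed
next
  assume R: "M \<subseteq> E \<and> (\<forall>e\<in>M. \<forall>f\<in>M. e \<noteq> f \<longrightarrow> \<not> linked E e f)"
  show "induced_matching E M"
    unfolding induced_matching_def regular_def degree_def
  proof (intro conjI ballI)
    show "M \<subseteq> E" using R by blast
    fix x assume "x \<in> \<Union>M"
    then obtain e where e: "e \<in> M" "x \<in> e" by blast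
    have "{l \<in> induced_edges E (\<Union>M). x \<in> l} = {e}"
    proof
      show "{e} \<subseteq> {l \<in> induced_edges E (\<Union>M). x \<in> l}"
        using e R unfolding induced_edges_def by blast
      show "{l \<in> induced_edges E (\<Union>M). x \<in> l} \<subseteq> {e}"
      proof
        fix l assume "l \<in> {l \<in> induced_edges E (\<Union>M). x \<in> l}"
        then have l: "l \<in> E" "l \<subseteq> \<Union>M" "x \<in> l" unfolding induced_edges_def by auto
        have "l \<subseteq> e"
        proof
          fix y assume "y \<in> l"
          then obtain f where "f \<in> M" "y \<in> f" using l by blast
          then have "linked E e f" using l e \<open>y \<in> l\<close> unfolding linked_def by blast
          then show "y \<in> e" using R e \<open>f \<in> M\<close> \<open>y \<in> f\<close> by blast
        qed
        moreover have "card l = card e" "finite e"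
          using g l(1) e R finite_subset unfolding fin_graph_def by auto
        ultimately show "l \<in> {e}" using card_subset_eq by blast
      qed
    qed
    then show "card {l \<in> induced_edges E (\<Union>M). x \<in> l} = 1" by simp
  qed
qed

lemma induced_matching_finite: "fin_graph V E \<Longrightarrow> induced_matching E M \<Longrightarrow> finite M"
  unfolding induced_matching_def using fin_graph_finite finite_subset by blast

lemma card_incident_edges:
  assumes g: "fin_graph V E" and r: "regular d V E" and e: "e \<in> E"
  shows "card {l \<in> E. l \<inter> e \<noteq> {}} = 2 * d - 1"
proof -
  obtain x y where xy: "e = {x, y}" "x \<noteq> y" "x \<in> V" "y \<in> V"
    using fin_graph_edgeE[OF g e] .
  have fin: "finite E" using g by (rule fin_graph_finite)
  have "{l \<in> E. x \<in> l} \<inter> {l \<in> E. y \<in> l} = {e}"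
  proof -
    have "l = e" if "l \<in> E" "x \<in> l" "y \<in> l" for l
      using fin_graph_edge_at[OF g that(1,2)] that(3) xy by (metis insertE singletonD)
    then show ?thesis using xy e by blast
  qed
  moreover have "card {l \<in> E. x \<in> l} = d" "card {l \<in> E. y \<in> l} = d"
    using r xy unfolding regular_def degree_def by auto
  moreover have "{l \<in> E. l \<inter> e \<noteq> {}} = {l \<in> E. x \<in> l} \<union> {l \<in> E. y \<in> l}"
    using xy by auto
  ultimately show ?thesis
    using card_Un_Int[of "{l \<in> E. x \<in> l}" "{l \<in> E. y \<in> l}"] fin by simp
qed

text \<open>
  An edge that meets two members links them, so the sets of edges met by the members are disjoint.
\<close>
lemma induced_matching_card_le:
  assumes g: "fin_graph V E" and r: "regular d V E" and M: "induced_matching E M"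
  shows "card M * (2 * d - 1) \<le> card E"
proof -
  have fin: "finite E" "finite M"
    using g M by (auto intro: fin_graph_finite induced_matching_finite)
  have ME: "M \<subseteq> E" and un: "\<forall>e\<in>M. \<forall>f\<in>M. e \<noteq> f \<longrightarrow> \<not> linked E e f"
    using M unfolding induced_matching_iff_unlinked[OF g] by auto
  have "card (\<Union>e\<in>M. {l \<in> E. l \<inter> e \<noteq> {}}) = (\<Sum>e\<in>M. card {l \<in> E. l \<inter> e \<noteq> {}})"
    using fin un unfolding linked_def by (intro card_UN_disjoint) auto
  also have "\<dots> = card M * (2 * d - 1)"
    using ME card_incident_edges[OF g r] by (simp add: subset_iff)
  finally show ?thesis
    using card_mono[of E "\<Union>e\<in>M. {l \<in> E. l \<inter> e \<noteq> {}}"] fin by fastforce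
qed

lemma nu_s_attained:
  assumes g: "fin_graph V E"
  obtains M where "induced_matching E M" "nu_s E = card M"
proof -
  have "{M. induced_matching E M} \<subseteq> Pow E" unfolding induced_matching_def by blast
  then have "finite (card ` {M. induced_matching E M})"
    using fin_graph_finite[OF g] finite_subset by blast
  moreover have "induced_matching E {}"
    unfolding induced_matching_def regular_def by simp
  ultimately have "nu_s E \<in> card ` {M. induced_matching E M}"
    unfolding nu_s_def by (intro Max_in) auto
  then show ?thesis using that by blast
qed

definition conflicts :: "'a set set \<Rightarrow> 'a set \<Rightarrow> 'a set set" where
  "conflicts E e = {l \<in> E. linked E l e}"

definition privates :: "'a set set \<Rightarrow> 'a set set \<Rightarrow> 'a set \<Rightarrow> 'a set set" where
  "privates E M e = {l \<in> conflicts E e. \<forall>f\<in>M - {e}. \<not> linked E l f}"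

lemma linked_to_matching:
  assumes g: "fin_graph V E" and M: "induced_matching E M"
    and no_add: "\<nexists>M'. add_move E M M'" and l: "l \<in> E"
  shows "\<exists>e\<in>M. linked E l e"
proof (rule ccontr)
  assume *: "\<not> ?thesis"
  then have "l \<notin> M" using linked_self[OF g l] by blast
  moreover have "induced_matching E (M \<union> {l})"
    using M l * unfolding induced_matching_iff_unlinked[OF g]
    by (auto simp: linked_commute)
  ultimately show False using no_add l unfolding add_move_def by blast
qed

text \<open>
  Every edge contributes at least two to the right-hand side: it is linked to two members of \<open>M\<close>, or
  it is linked to exactly one and is then private to that one.
\<close>
lemma twice_card_edges_le:
  assumes g: "fin_graph V E" and M: "induced_matching E M"
    and no_add: "\<nexists>M'. add_move E M M'"
  shows "2 * card E \<le> (\<Sum>e\<in>M. card (conflicts E e) + card (privates E M e))"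
proof -
  have fin: "finite E" "finite M"
    using g M by (auto intro: fin_graph_finite induced_matching_finite)
  let ?w = "\<lambda>l e. of_bool (l \<in> conflicts E e) + of_bool (l \<in> privates E M e) :: nat"
  have two: "2 \<le> (\<Sum>e\<in>M. ?w l e)" if l: "l \<in> E" for l
  proof -
    obtain e where e: "e \<in> M" "linked E l e"
      using linked_to_matching[OF g M no_add l] by blast
    then have c: "l \<in> conflicts E e" using l unfolding conflicts_def by blast
    show ?thesis
    proof (cases "\<exists>f\<in>M - {e}. linked E l f")
      case True
      then obtain f where f: "f \<in> M - {e}" "l \<in> conflicts E f"
        using l unfolding conflicts_def by blast
      have "e \<noteq> f" using f by blast
      then have "2 \<le> (\<Sum>e\<in>{e, f}. ?w l e)" using f c by simp
      also have "\<dots> \<le> (\<Sum>e\<in>M. ?w l e)"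
        using fin e f by (intro sum_mono2) auto
      finally show ?thesis .
    next
      case False
      then have "?w l e = 2" using c unfolding privates_def by auto
      then show ?thesis using member_le_sum[of e M "?w l"] fin e by simp
    qed
  qed
  have card_eq: "card X = (\<Sum>l\<in>E. of_bool (l \<in> X))" if "X \<subseteq> E" for X
    using fin that by (simp add: of_bool_def sum.If_cases Int_absorb1 Int_commute)
  have "2 * card E = (\<Sum>l\<in>E. 2)" by simp
  also have "\<dots> \<le> (\<Sum>l\<in>E. \<Sum>e\<in>M. ?w l e)" using two by (rule sum_mono)
  also have "\<dots> = (\<Sum>e\<in>M. \<Sum>l\<in>E. ?w l e)" by (rule sum.swap)
  also have "\<dots> = (\<Sum>e\<in>M. card (conflicts E e) + card (privates E M e))"
    by (intro sum.cong refl)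
       (subst card_eq, force simp: conflicts_def privates_def,
        subst card_eq, force simp: conflicts_def privates_def, simp add: sum.distrib)
  finally show ?thesis .
qed

text \<open>
  Otherwise \<open>e\<close> could be swapped for \<open>k\<close> and \<open>l\<close>, which are unlinked to all other members.
\<close>
lemma privates_linked:
  assumes g: "fin_graph V E" and M: "induced_matching E M" and e: "e \<in> M"
    and no_swap: "\<nexists>M'. swap_move E M M'"
    and k: "k \<in> privates E M e" "k \<noteq> e" and l: "l \<in> privates E M e" "l \<noteq> e"
  shows "linked E k l"
proof (rule ccontr)
  assume "\<not> linked E k l"
  have un: "M \<subseteq> E" "\<forall>e\<in>M. \<forall>f\<in>M. e \<noteq> f \<longrightarrow> \<not> linked E e f"
    using M unfolding induced_matching_iff_unlinked[OF g] by auto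
  have in_E: "k \<in> E" "l \<in> E" using k l unfolding privates_def conflicts_def by auto
  then have "k \<noteq> l" using \<open>\<not> linked E k l\<close> linked_self[OF g] by blast
  have "k \<notin> M" "l \<notin> M"
    using k l un e unfolding privates_def conflicts_def by auto
  moreover have "induced_matching E ((M - {e}) \<union> {k, l})"
    unfolding induced_matching_iff_unlinked[OF g]
    using un in_E k l \<open>\<not> linked E k l\<close> unfolding privates_def
    by (auto simp: linked_commute)
  ultimately have "swap_move E M ((M - {e}) \<union> {k, l})"
    unfolding swap_move_def using e in_E \<open>k \<noteq> l\<close> by blast
  then show False using no_swap by blast
qed

definition nbs :: "'a set set \<Rightarrow> 'a \<Rightarrow> 'a set" where
  "nbs E x = {y. {x, y} \<in> E}"

lemma inj_on_edge: "inj_on (\<lambda>y. {x, y}) A"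
  by (rule inj_onI) (metis doubleton_eq_iff)

lemma card_nbs:
  assumes g: "fin_graph V E"
  shows "card (nbs E x) = degree E x"
proof -
  have "{l \<in> E. x \<in> l} = (\<lambda>y. {x, y}) ` nbs E x"
  proof -
    have "\<exists>y. l = {x, y}" if "l \<in> E" "x \<in> l" for l
      using fin_graph_edge_at[OF g that] by metis
    then show ?thesis unfolding nbs_def by blast
  qed
  then show ?thesis unfolding degree_def using card_image[OF inj_on_edge] by metis
qed

lemma finite_nbs:
  assumes g: "fin_graph V E"
  shows "finite (nbs E x)"
proof -
  have "nbs E x \<subseteq> V" using g unfolding nbs_def fin_graph_def by blast
  then show ?thesis using g finite_subset unfolding fin_graph_def by blast
qed

text \<open>
  The degrees in \<open>N\<close> sum up to the right-hand side and count an edge inside \<open>N\<close> twice.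
\<close>
lemma edges_meeting_le:
  assumes fin: "finite E" "finite N" and d: "\<And>x. x \<in> N \<Longrightarrow> degree E x = d"
    and two: "\<And>l. l \<in> E \<Longrightarrow> card l = 2"
  shows "card {l \<in> E. l \<inter> N \<noteq> {}} + card {l \<in> E. l \<subseteq> N} \<le> d * card N"
proof -
  have "card {l \<in> E. l \<inter> N \<noteq> {}} + card {l \<in> E. l \<subseteq> N}
      = (\<Sum>l\<in>E. of_bool (l \<inter> N \<noteq> {}) + of_bool (l \<subseteq> N))"
    using fin by (simp add: sum.distrib Int_def)
  also have "\<dots> \<le> (\<Sum>l\<in>E. card (l \<inter> N))"
  proof (rule sum_mono)
    fix l assume l: "l \<in> E"
    show "of_bool (l \<inter> N \<noteq> {}) + of_bool (l \<subseteq> N) \<le> card (l \<inter> N)"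
    proof (cases "l \<subseteq> N")
      case True
      then show ?thesis using two[OF l] by (auto simp: Int_absorb2)
    next
      case False
      then show ?thesis using fin card_gt_0_iff[of "l \<inter> N"] by auto
    qed
  qed
  also have "\<dots> = (\<Sum>l\<in>E. \<Sum>x\<in>N. of_bool (x \<in> l))"
    using fin by (simp add: Int_commute Int_def)
  also have "\<dots> = (\<Sum>x\<in>N. \<Sum>l\<in>E. of_bool (x \<in> l))" by (rule sum.swap)
  also have "\<dots> = (\<Sum>x\<in>N. degree E x)"
    using fin by (simp add: degree_def Int_def)
  also have "\<dots> = d * card N" using d by simp
  finally show ?thesis .
qed

lemma C5_freeD:
  assumes g: "fin_graph V E" and free: "C5_free V E"
    and dist: "distinct [x0, x1, x2, x3, x4]"
    and edges: "{x0, x1} \<in> E" "{x1, x2} \<in> E" "{x2, x3} \<in> E" "{x3, x4} \<in> E" "{x4, x0} \<in> E"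
  shows "{x0, x2} \<in> E \<or> {x1, x3} \<in> E \<or> {x2, x4} \<in> E \<or> {x3, x0} \<in> E \<or> {x4, x1} \<in> E"
proof (rule ccontr)
  assume non: "\<not> ?thesis"
  let ?S = "{x0, x1, x2, x3, x4}"
  define f :: "'a \<Rightarrow> nat" where
    "f x = (if x = x0 then 0 else if x = x1 then 1 else if x = x2 then 2 else if x = x3 then 3 else 4)" for x
  have f: "f x0 = 0" "f x1 = 1" "f x2 = 2" "f x3 = 3" "f x4 = 4"
    using dist unfolding f_def by auto
  have cyc: "cycle_edges 5 = {{0, 1}, {1, 2}, {2, 3}, {3, 4}, {4, 0}}"
  proof -
    have "{i. i < (5::nat)} = {0, 1, 2, 3, 4}" by auto
    moreover have "cycle_edges 5 = (\<lambda>i. {i, (i + 1) mod 5}) ` {i. i < 5}"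
      unfolding cycle_edges_def by auto
    ultimately show ?thesis by (simp add: numeral_2_eq_2)
  qed
  have loop: "{x} \<notin> E" for x using fin_graph_edge_neq[OF g, of x x] by auto
  have "{..<5::nat} = {0, 1, 2, 3, 4}" by auto
  then have "bij_betw f ?S {..<5}"
    unfolding bij_betw_def inj_on_def using f by auto
  moreover have "{x, y} \<in> induced_edges E ?S \<longleftrightarrow> {f x, f y} \<in> cycle_edges 5"
    if "x \<in> ?S" "y \<in> ?S" for x y
    using that edges non loop unfolding cyc induced_edges_def
    by (elim insertE emptyE) (simp_all add: f doubleton_eq_iff insert_commute)
  ultimately have "isomorphic ?S (induced_edges E ?S) {..<5} (cycle_edges 5)"
    unfolding isomorphic_def by blast
  moreover have "?S \<subseteq> V" using edges g unfolding fin_graph_def by auto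
  ultimately show False using free unfolding C5_free_def by blast
qed

section \<open>Matchings that admit neither move\<close>

locale local_optimum =
  fixes V :: "'a set" and E M d
  assumes graph: "fin_graph V E" and reg: "regular d V E" and free: "C5_free V E"
    and matching: "induced_matching E M"
    and no_add: "\<nexists>M'. add_move E M M'" and no_swap: "\<nexists>M'. swap_move E M M'"
begin

lemma finE: "finite E" by (rule fin_graph_finite[OF graph])

lemma M_sub: "M \<subseteq> E" and M_unlinked: "e \<in> M \<Longrightarrow> f \<in> M \<Longrightarrow> e \<noteq> f \<Longrightarrow> \<not> linked E e f"
  using matching unfolding induced_matching_iff_unlinked[OF graph] by auto

lemma degree_in_edge: "{x, y} \<in> E \<Longrightarrow> degree E x = d"
  using reg graph unfolding regular_def fin_graph_def by blast

text \<open>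
  An edge is unlinked to all members of \<open>M\<close> other than \<open>e\<close> if and only if both of its ends are undominated.
  This makes being private a property of vertices (\<open>privates_eq\<close>).
\<close>

definition undominated :: "'a set \<Rightarrow> 'a set" where
  "undominated e = {x. \<forall>f\<in>M - {e}. \<forall>l\<in>E. x \<in> l \<longrightarrow> l \<inter> f = {}}"

lemma privates_eq: "privates E M e = {l \<in> E. linked E l e \<and> l \<subseteq> undominated e}"
  unfolding privates_def conflicts_def undominated_def linked_def by blast

lemma matching_edge_undominated: "e \<in> M \<Longrightarrow> e \<subseteq> undominated e"
  using M_unlinked unfolding undominated_def linked_def by blast

text \<open>
  The edges \<open>az\<close> and \<open>vb\<close> are private to \<open>uv\<close> and hence linked. Neither \<open>av\<close> nor \<open>zv\<close> is an edge, so
  the link is \<open>ab\<close> or \<open>zb\<close>; in the latter case the five-cycle \<open>u, a, z, b, v\<close> can only have the chord \<open>ab\<close>.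
\<close>
lemma private_path_complete:
  assumes uv: "{u, v} \<in> M"
    and a: "{u, a} \<in> E" "{v, a} \<notin> E" "a \<noteq> v" "a \<in> undominated {u, v}"
    and b: "{v, b} \<in> E" "{u, b} \<notin> E" "b \<noteq> u" "b \<in> undominated {u, v}"
    and z: "{a, z} \<in> E" "{u, z} \<notin> E" "{v, z} \<notin> E" "z \<noteq> u" "z \<noteq> v" "z \<in> undominated {u, v}"
  shows "{a, b} \<in> E"
proof (rule ccontr)
  assume ab: "{a, b} \<notin> E"
  have uvE: "{u, v} \<in> E" using uv M_sub by blast
  have neq: "u \<noteq> v" "u \<noteq> a" "v \<noteq> b" "a \<noteq> z"
    using fin_graph_edge_neq[OF graph] uvE a b z by blast+
  have "u \<in> undominated {u, v}" "v \<in> undominated {u, v}"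
    using matching_edge_undominated[OF uv] by auto
  then have "{a, z} \<in> privates E M {u, v}" "{v, b} \<in> privates E M {u, v}"
  proof -
    have "linked E {a, z} {u, v}" unfolding linked_def using a(1) by (intro bexI[of _ "{u, a}"]) auto
    moreover have "linked E {v, b} {u, v}" using b(1) by (rule linkedI_common[of _ _ v]) auto
    ultimately show "{a, z} \<in> privates E M {u, v}" "{v, b} \<in> privates E M {u, v}"
      unfolding privates_eq using a(4) b(1,4) z(1,6) \<open>v \<in> undominated {u, v}\<close> by simp_all
  qed
  moreover have "{a, z} \<noteq> {u, v}" "{v, b} \<noteq> {u, v}" using a b z neq by auto
  ultimately have "linked E {a, z} {v, b}"
    using privates_linked[OF graph matching uv no_swap] by blast
  then obtain l x y where l: "l \<in> E" "x \<in> l" "x \<in> {a, z}" "y \<in> l" "y \<in> {v, b}"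
    unfolding linked_def by blast
  have "a \<noteq> b" "z \<noteq> b" using a b z by auto
  then have "x \<noteq> y" using l a z by auto
  then have "{x, y} \<in> E" using fin_graph_edge_at[OF graph l(1,2)] l(1,4) by (metis insertE singletonD)
  then have zb: "{z, b} \<in> E" using l ab a z by (auto simp: insert_commute)
  have "distinct [u, a, z, b, v]"
    using neq \<open>a \<noteq> b\<close> \<open>z \<noteq> b\<close> a b z by auto
  from C5_freeD[OF graph free this] show False
    using a b z zb uvE ab by (simp add: insert_commute)
qed

text \<open>
  If \<open>a\<close> has a private edge to a vertex \<open>z\<close> at distance two from \<open>uv\<close>, it is adjacent to all of \<open>B\<close> by
  \<open>private_path_complete\<close>, and these edges lie inside \<open>N\<close>. Otherwise \<open>ua\<close> is the only edge to be
  counted, and \<open>card B < d\<close> because \<open>u\<close> is a neighbour of \<open>v\<close> outside \<open>B\<close>.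
\<close>
lemma private_edges_at_le:
  assumes uv: "{u, v} \<in> M"
    and a: "{u, a} \<in> E" "{v, a} \<notin> E" "a \<noteq> v" "a \<in> undominated {u, v}"
    and N: "N = nbs E u \<union> nbs E v - {u, v}"
    and B: "B = (nbs E v - nbs E u - {u}) \<inter> undominated {u, v}"
  shows "card {l \<in> E. a \<in> l \<and> l \<subseteq> undominated {u, v} \<and> \<not> l \<subseteq> N} \<le> d - card B" (is "card ?P \<le> _")
proof -
  have uvE: "{u, v} \<in> E" using uv M_sub by blast
  have neq: "u \<noteq> v" "u \<noteq> a" using fin_graph_edge_neq[OF graph] uvE a by blast+
  have "B \<subseteq> nbs E v - {u}" unfolding B by blast
  moreover have "card (nbs E v - {u}) = d - 1"
    using uvE card_nbs[OF graph, of v] degree_in_edge[of v u] 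
    by (simp add: nbs_def insert_commute)
  moreover have finB: "finite B" unfolding B using finite_nbs[OF graph] by blast
  ultimately have "card B \<le> d - 1"
    using card_mono finite_nbs[OF graph] by (metis finite_Diff)
  moreover have d0: "d > 0"
    using degree_in_edge[OF uvE] finE uvE unfolding degree_def by (auto simp: card_gt_0_iff)
  ultimately have Bd: "1 \<le> d - card B" by linarith
  show ?thesis
  proof (cases "\<exists>z. {a, z} \<in> E \<and> {u, z} \<notin> E \<and> {v, z} \<notin> E \<and> z \<noteq> u \<and> z \<noteq> v \<and> z \<in> undominated {u, v}")
    case True
    then obtain z where z: "{a, z} \<in> E" "{u, z} \<notin> E" "{v, z} \<notin> E" "z \<noteq> u" "z \<noteq> v" "z \<in> undominated {u, v}"
      by blast
    have ab: "{a, b} \<in> E" if "b \<in> B" for b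
      using private_path_complete[OF uv a _ _ _ _ z] that unfolding B nbs_def by blast
    have aN: "a \<in> N" and BN: "B \<subseteq> N"
      using a neq fin_graph_edge_neq[OF graph] unfolding N B nbs_def by auto
    have "?P \<subseteq> {l \<in> E. a \<in> l} - (\<lambda>b. {a, b}) ` B"
      using aN BN by auto
    then have "card ?P \<le> card ({l \<in> E. a \<in> l} - (\<lambda>b. {a, b}) ` B)"
      using finE by (intro card_mono) auto
    also have "\<dots> = card {l \<in> E. a \<in> l} - card ((\<lambda>b. {a, b}) ` B)"
      using ab finB by (intro card_Diff_subset) auto
    also have "\<dots> = d - card B"
      using degree_in_edge[of a z] z by (simp add: card_image[OF inj_on_edge] degree_def)
    finally show ?thesis .
  next
    case False
    have "?P \<subseteq> {{u, a}}"
    proof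
      fix l assume l: "l \<in> ?P"
      then obtain w where w: "l = {a, w}" "a \<noteq> w" using fin_graph_edge_at[OF graph] by blast
      have "a \<in> N" using a neq unfolding N nbs_def by auto
      then have "w \<notin> N" using l w by auto
      moreover have "w \<noteq> v" using l w a by (auto simp: insert_commute)
      ultimately have "w = u" using False l w unfolding N nbs_def by auto
      then show "l \<in> {{u, a}}" using w by auto
    qed
    then have "card ?P \<le> card {{u, a}}" by (intro card_mono) auto
    then show ?thesis using Bd by simp
  qed
qed

lemma card_UN_const_le:
  assumes "finite X" "\<And>x. x \<in> X \<Longrightarrow> card (f x) \<le> k"
  shows "card (\<Union>x\<in>X. f x) \<le> card X * k"
proof -
  have "card (\<Union>x\<in>X. f x) \<le> (\<Sum>x\<in>X. card (f x))" using assms(1) by (rule card_UN_le)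
  also have "\<dots> \<le> card X * k" using sum_bounded_above[of X "\<lambda>x. card (f x)" k, OF assms(2)] by simp
  finally show ?thesis .
qed

text \<open>
  Let \<open>t\<close> be the number of common neighbours of \<open>u\<close> and \<open>v\<close>, and \<open>i\<close> the number of edges
  inside the set \<open>N\<close> of all their other neighbours. Then \<open>|N| = 2(d - 1) - t\<close>, and the edges linked
  to \<open>e\<close> are \<open>e\<close> and those that meet \<open>N\<close>; these are at most \<open>1 + d|N| - i\<close>. The private
  edges are \<open>e\<close>, at most \<open>i\<close> edges inside \<open>N\<close>, at most \<open>td\<close> edges at common neighbours, and, with \<open>\<alpha>\<close> and
  \<open>\<beta>\<close> undominated vertices adjacent only to \<open>u\<close> and only to \<open>v\<close>, at most \<open>\<alpha>(d - \<beta>) + \<beta>(d - \<alpha>)\<close> others. The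
  terms in \<open>t\<close> and \<open>i\<close> cancel.
\<close>
lemma conflicts_privates_le:
  assumes e: "e \<in> M"
  shows "card (conflicts E e) + card (privates E M e) + 2 * d \<le> 3 * d^2 + 1"
proof -
  have eE: "e \<in> E" using e M_sub by blast
  obtain u v where uv: "e = {u, v}" "u \<noteq> v"
    using fin_graph_edgeE[OF graph eE] by blast
  have uvE: "{u, v} \<in> E" "{v, u} \<in> E" using eE uv by (auto simp: insert_commute)
  have uvM: "{u, v} \<in> M" "{v, u} \<in> M" using e uv by (auto simp: insert_commute)
  have d0: "d > 0"
    using degree_in_edge[OF uvE(1)] finE uvE unfolding degree_def by (auto simp: card_gt_0_iff)
  define Nu where "Nu = nbs E u - {v}"
  define Nv where "Nv = nbs E v - {u}"
  define N where "N = nbs E u \<union> nbs E v - {u, v}"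
  define T where "T = Nu \<inter> Nv"
  define Q where "Q = undominated e"
  define A where "A = (Nu - Nv) \<inter> Q"
  define B where "B = (Nv - Nu) \<inter> Q"
  define I where "I = {l \<in> E. l \<subseteq> N}"
  have loop: "{x} \<notin> E" for x using fin_graph_edge_neq[OF graph, of x x] by auto
  have N_eq: "N = Nu \<union> Nv" unfolding N_def Nu_def Nv_def nbs_def using loop by auto
  have fin: "finite Nu" "finite Nv" "finite N" "finite T" "finite A" "finite B" "finite I"
    using finite_nbs[OF graph] finE unfolding Nu_def Nv_def N_eq T_def A_def B_def I_def by auto
  have cards: "card Nu = d - 1" "card Nv = d - 1"
    unfolding Nu_def Nv_def using uvE card_nbs[OF graph] degree_in_edge
    by (simp_all add: nbs_def)
  have "card N + card T = 2 * (d - 1)"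
    using card_Un_Int[of Nu Nv] fin cards unfolding N_eq T_def by simp
  then have N_card: "card N + card T + 2 = 2 * d" using d0 by simp
  have deg: "degree E x = d" if "x \<in> N" for x
    using that degree_in_edge[of x u] degree_in_edge[of x v]
    unfolding N_def nbs_def by (auto simp: insert_commute)

  have "conflicts E e \<subseteq> insert e {l \<in> E. l \<inter> N \<noteq> {}}"
  proof
    fix l assume "l \<in> conflicts E e"
    then obtain k x y where l: "l \<in> E" "k \<in> E" "x \<in> k" "x \<in> l" "y \<in> k" "y \<in> {u, v}"
      unfolding conflicts_def linked_def uv by blast
    obtain x' where x': "l = {x, x'}" "x \<noteq> x'" using fin_graph_edge_at[OF graph l(1,4)] .
    show "l \<in> insert e {l \<in> E. l \<inter> N \<noteq> {}}"
    proof (cases "x \<in> {u, v}")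
      case True
      then have "x' \<in> {u, v} \<or> x' \<in> N" using l x' unfolding N_def nbs_def by auto
      then show ?thesis using l x' True uv by auto
    next
      case False
      then have "x \<noteq> y" using l by blast
      then have "k = {y, x}" using fin_graph_edge_at[OF graph l(2,3)] l by (metis insert_commute insertE singletonD)
      then have "x \<in> N" using l False unfolding N_def nbs_def by auto
      then show ?thesis using l by auto
    qed
  qed
  then have "card (conflicts E e) \<le> card (insert e {l \<in> E. l \<inter> N \<noteq> {}})"
    using finE by (intro card_mono) auto
  also have "\<dots> \<le> 1 + card {l \<in> E. l \<inter> N \<noteq> {}}"
    using card_insert_le_m1 finE by (simp add: card_insert_if)
  finally have "card (conflicts E e) + card I \<le> 1 + d * card N"
    using edges_meeting_le[OF finE fin(3) deg] graph unfolding I_def fin_graph_def by force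
  moreover have "d * card N + d * card T + 2 * d = 2 * d * d"
    using N_card by (metis add_mult_distrib2 mult.assoc mult.commute)
  ultimately have C: "card (conflicts E e) + card I + d * card T + 2 * d \<le> 1 + 2 * d^2"
    by (simp add: power2_eq_square)

  define outer where "outer x = {l \<in> E. x \<in> l \<and> l \<subseteq> Q \<and> \<not> l \<subseteq> N}" for x
  have "privates E M e \<subseteq> {e} \<union> I \<union> (\<Union>x\<in>T. {l \<in> E. x \<in> l}) \<union> (\<Union>x\<in>A. outer x) \<union> (\<Union>x\<in>B. outer x)"
  proof
    fix l assume l: "l \<in> privates E M e"
    then have lE: "l \<in> E" "l \<subseteq> Q" "l \<in> conflicts E e"
      unfolding Q_def privates_eq conflicts_def by auto
    then consider "l = e" | x where "x \<in> l" "x \<in> N"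
      using \<open>conflicts E e \<subseteq> _\<close> by auto
    then show "l \<in> {e} \<union> I \<union> (\<Union>x\<in>T. {l \<in> E. x \<in> l}) \<union> (\<Union>x\<in>A. outer x) \<union> (\<Union>x\<in>B. outer x)"
      using lE unfolding N_eq I_def outer_def A_def B_def T_def by cases auto
  qed
  then have "card (privates E M e) \<le> card ({e} \<union> I \<union> (\<Union>x\<in>T. {l \<in> E. x \<in> l}) \<union> (\<Union>x\<in>A. outer x) \<union> (\<Union>x\<in>B. outer x))"
    using fin finE by (intro card_mono) (auto simp: outer_def)
  also have "\<dots> \<le> card {e} + card I + card (\<Union>x\<in>T. {l \<in> E. x \<in> l}) + card (\<Union>x\<in>A. outer x) + card (\<Union>x\<in>B. outer x)"
    by (intro order_trans[OF card_Un_le] add_right_mono order_refl)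
  also have "\<dots> \<le> 1 + card I + card T * d + card A * (d - card B) + card B * (d - card A)"
  proof (intro add_mono card_UN_const_le fin order_refl)
    show "card {e} \<le> 1" by simp
    show "card {l \<in> E. x \<in> l} \<le> d" if "x \<in> T" for x
      using deg[of x] that unfolding degree_def T_def N_eq by auto
    show "card (outer x) \<le> d - card B" if x: "x \<in> A" for x
    proof -
      have "card B = card ((nbs E v - nbs E u - {u}) \<inter> undominated {u, v})"
        unfolding B_def Nu_def Nv_def Q_def uv using loop by (intro arg_cong[where f = card]) (auto simp: nbs_def)
      moreover have ux: "{u, x} \<in> E" "{v, x} \<notin> E" "x \<noteq> v" "x \<in> undominated {u, v}"
        using x loop unfolding A_def Nu_def Nv_def nbs_def Q_def uv by auto
      ultimately show ?thesis
        using private_edges_at_le[OF uvM(1) ux N_def refl] by (simp add: outer_def Q_def uv)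
    qed
    show "card (outer x) \<le> d - card A" if x: "x \<in> B" for x
    proof -
      have "card A = card ((nbs E u - nbs E v - {v}) \<inter> undominated {v, u})"
        unfolding A_def Nu_def Nv_def Q_def uv using loop
        by (intro arg_cong[where f = card]) (auto simp: nbs_def insert_commute)
      moreover have vx: "{v, x} \<in> E" "{u, x} \<notin> E" "x \<noteq> u" "x \<in> undominated {v, u}"
        using x loop unfolding B_def Nu_def Nv_def nbs_def Q_def uv by (auto simp: insert_commute)
      moreover have N': "N = nbs E v \<union> nbs E u - {v, u}" unfolding N_def by blast
      moreover have "{v, u} = {u, v}" by blast
      ultimately show ?thesis
        using private_edges_at_le[OF uvM(2) vx N' refl] by (simp add: outer_def Q_def uv)
    qed
  qed
  finally have P: "card (privates E M e) \<le>
      1 + card I + card T * d + card A * (d - card B) + card B * (d - card A)" .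
  have "card A \<le> d - 1" "card B \<le> d - 1"
    using card_mono[of Nu A] card_mono[of Nv B] fin cards unfolding A_def B_def by auto
  then obtain p q where pq: "d = card A + p" "d = card B + q" "p > 0" "q > 0"
    using d0 by (metis add_diff_inverse_nat diff_less le_less_trans less_imp_add_positive zero_less_one)
  \<comment> \<open>Both \<open>\<alpha>\<close> and \<open>\<beta>\<close> are less than \<open>d\<close>, and \<open>d\<^sup>2 - \<alpha>(d - \<beta>) - \<beta>(d - \<alpha>) = (d - \<alpha>)(d - \<beta>) + \<alpha>\<beta>\<close>.\<close>
  have "1 + card A * (d - card B) + card B * (d - card A) \<le> d^2"
  proof -
    have "1 \<le> p * q" using pq by simp
    moreover have "d^2 = card A * q + card B * p + card A * card B + p * q"
    proof -
      have "d^2 = (card A + p) * (card B + q)" using pq by (simp add: power2_eq_square)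
      then show ?thesis by (simp add: algebra_simps)
    qed
    moreover have "d - card B = q" "d - card A = p" using pq by simp_all
    ultimately show ?thesis by (simp only:)
  qed
  with C P show ?thesis by (simp add: mult.commute)
qed

lemma card_edges_le: "2 * card E + 2 * d * card M \<le> (3 * d^2 + 1) * card M"
proof -
  have "2 * card E + 2 * d * card M
      \<le> (\<Sum>e\<in>M. card (conflicts E e) + card (privates E M e) + 2 * d)"
    using twice_card_edges_le[OF graph matching no_add] by (simp add: sum.distrib mult.commute)
  also have "\<dots> \<le> (\<Sum>e\<in>M. 3 * d^2 + 1)" using conflicts_privates_le by (rule sum_mono)
  finally show ?thesis by (simp add: mult.commute)
qed

lemma nu_s_le:
  assumes "d \<ge> 1"
  shows "real (nu_s E) \<le> (3 / 4 * real d - 1 / 8 + 3 / (16 * real d - 8)) * real (card M)"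
proof -
  obtain N where N: "induced_matching E N" "nu_s E = card N" using nu_s_attained[OF graph] .
  have "2 * (nu_s E * (2 * d - 1)) + 2 * d * card M \<le> (3 * d^2 + 1) * card M"
    using induced_matching_card_le[OF graph reg N(1)] card_edges_le N(2) by simp
  then have *: "real (2 * (nu_s E * (2 * d - 1)) + 2 * d * card M) \<le> real ((3 * d^2 + 1) * card M)"
    by (rule of_nat_mono)
  have "real (nu_s E) * (2 * (2 * real d - 1)) \<le> (3 * (real d)^2 - 2 * real d + 1) * real (card M)"
  proof -
    have "real (2 * d - 1) = 2 * real d - 1" using assms by (simp add: of_nat_diff)
    with * show ?thesis
      by (simp only: of_nat_add of_nat_mult of_nat_power) (simp add: algebra_simps)
  qed
  moreover have "(3 * (real d)^2 - 2 * real d + 1) * real (card M)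
      = (3 / 4 * real d - 1 / 8 + 3 / (16 * real d - 8)) * real (card M) * (2 * (2 * real d - 1))"
    using assms by (simp add: field_simps power2_eq_square)
  moreover have "2 * (2 * real d - 1) > 0" using assms by simp
  ultimately show ?thesis by (metis mult_le_cancel_right_pos)
qed

end

section \<open>Outcomes and running time of programs\<close>

lemma set_reg_simps [simp]:
  "reg (set_reg x k s) = (reg s)(x := k)" "arr (set_reg x k s) = arr s"
  "arr (set_arr A i k s) = (arr s)(A := (arr s A)(i := k))" "reg (set_arr A i k s) = reg s"
  unfolding set_reg_def set_arr_def by simp_all

inductive_cases step_SeqE: "step (Seq c1 c2, s) cfg"
inductive_cases step_AssignE: "step (Assign x a, s) cfg"
inductive_cases step_WriteE: "step (Write A a b, s) cfg"
inductive_cases step_ChooseE: "step (Choose x a, s) cfg"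
inductive_cases step_IfE: "step (If b c1 c2, s) cfg"
inductive_cases step_WhileE: "step (While b c, s) cfg"

lemma final_states_iff: "s' \<in> final_states c s \<longleftrightarrow> (\<exists>k. (step ^^ k) (c, s) (Skip, s'))"
  unfolding final_states_def by (simp add: rtranclp_power)

lemma steps_Skip: "(step ^^ k) (Skip, s) cfg \<longleftrightarrow> k = 0 \<and> cfg = (Skip, s)"
proof (cases k)
  case (Suc j)
  then show ?thesis using relpowp_Suc_D2[of j step "(Skip, s)" cfg] Skip_final by auto
qed auto

lemma runs_within_step:
  assumes "\<And>cfg. step (c, s) cfg \<Longrightarrow> runs_within (fst cfg) (snd cfg) t"
  shows "runs_within c s (Suc t)"
  unfolding runs_within_def
proof (intro allI impI)
  fix k cfg assume k: "(step ^^ k) (c, s) cfg"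
  show "k \<le> Suc t"
  proof (cases k)
    case (Suc j)
    then obtain cfg' where "step (c, s) cfg'" "(step ^^ j) cfg' cfg"
      using k by (metis relpowp_Suc_D2)
    then have "j \<le> t" using assms[of cfg'] unfolding runs_within_def by (metis prod.collapse)
    then show ?thesis using Suc by simp
  qed simp
qed

lemma final_states_step:
  assumes "c \<noteq> Skip"
  shows "final_states c s = (\<Union>cfg\<in>{cfg. step (c, s) cfg}. final_states (fst cfg) (snd cfg))"
proof -
  have "step\<^sup>*\<^sup>* (c, s) (Skip, s') \<longleftrightarrow> (\<exists>cfg. step (c, s) cfg \<and> step\<^sup>*\<^sup>* cfg (Skip, s'))" for s'
  proof
    assume "step\<^sup>*\<^sup>* (c, s) (Skip, s')"
    then show "\<exists>cfg. step (c, s) cfg \<and> step\<^sup>*\<^sup>* cfg (Skip, s')"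
      by (cases rule: converse_rtranclpE) (use assms in auto)
  qed (auto intro: converse_rtranclp_into_rtranclp)
  then show ?thesis unfolding final_states_def by auto
qed

lemma final_states_Skip: "final_states Skip s = {s}"
  using final_states_iff[of _ Skip s] steps_Skip by auto

lemma runs_within_Skip: "runs_within Skip s t"
  unfolding runs_within_def by (simp add: steps_Skip)

lemma runs_within_mono: "runs_within c s t \<Longrightarrow> t \<le> t' \<Longrightarrow> runs_within c s t'"
  unfolding runs_within_def by (meson order_trans)

text \<open>
  The middle summand of \<open>k1 + 1 + k2\<close> is the step that discards the completed first part.
\<close>
lemma steps_Seq:
  assumes "(step ^^ k) (Seq c1 c2, s) cfg"
  shows "(\<exists>c1' s'. cfg = (Seq c1' c2, s') \<and> (step ^^ k) (c1, s) (c1', s')) \<or>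
    (\<exists>k1 s' k2. (step ^^ k1) (c1, s) (Skip, s') \<and> (step ^^ k2) (c2, s') cfg \<and> k = k1 + 1 + k2)"
  using assms
proof (induction k arbitrary: cfg)
  case 0
  then show ?case by simp
next
  case (Suc k)
  then obtain cfg' where cfg': "(step ^^ k) (Seq c1 c2, s) cfg'" "step cfg' cfg"
    by (meson relpowp_Suc_E)
  from Suc.IH[OF cfg'(1)] show ?case
  proof (elim disjE exE conjE)
    fix c1' s' assume *: "cfg' = (Seq c1' c2, s')" "(step ^^ k) (c1, s) (c1', s')"
    from cfg'(2) * consider "c1' = Skip" "cfg = (c2, s')"
      | c' s'' where "cfg = (Seq c' c2, s'')" "step (c1', s') (c', s'')"
      by (auto elim: step_SeqE)
    then show ?case
    proof cases
      case 1
      then have "(step ^^ k) (c1, s) (Skip, s')" "(step ^^ 0) (c2, s') cfg" "Suc k = k + 1 + 0"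
        using * by auto
      then show ?thesis by blast
    next
      case 2
      then have "(step ^^ Suc k) (c1, s) (c', s'')" using * by auto
      then show ?thesis using 2 by blast
    qed
  next
    fix k1 s' k2
    assume "(step ^^ k1) (c1, s) (Skip, s')" "(step ^^ k2) (c2, s') cfg'" "k = k1 + 1 + k2"
    moreover from this have "(step ^^ Suc k2) (c2, s') cfg" using cfg'(2) by auto
    ultimately show ?case by (metis add_Suc_right)
  qed
qed

lemma steps_Seq_left:
  "step\<^sup>*\<^sup>* (c1, s) (c1', s') \<Longrightarrow> step\<^sup>*\<^sup>* (Seq c1 c2, s) (Seq c1' c2, s')"
proof (induction rule: rtranclp_induct2)
  case (step c s c' s')
  then show ?case by (meson rtranclp.rtrancl_into_rtrancl step.SeqStep)
qed simp

lemma final_states_Seq: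
  "final_states (Seq c1 c2) s = (\<Union>s'\<in>final_states c1 s. final_states c2 s')"
proof
  show "final_states (Seq c1 c2) s \<subseteq> (\<Union>s'\<in>final_states c1 s. final_states c2 s')"
  proof
    fix s'' assume "s'' \<in> final_states (Seq c1 c2) s"
    then obtain k where "(step ^^ k) (Seq c1 c2, s) (Skip, s'')" unfolding final_states_iff by blast
    from steps_Seq[OF this] show "s'' \<in> (\<Union>s'\<in>final_states c1 s. final_states c2 s')"
      unfolding UN_iff final_states_iff Bex_def by blast
  qed
  show "(\<Union>s'\<in>final_states c1 s. final_states c2 s') \<subseteq> final_states (Seq c1 c2) s"
    using steps_Seq_left[of c1 s Skip _ c2] step.SeqSkip[of c2]
    unfolding final_states_def
    by clarsimp (meson converse_rtranclp_into_rtranclp rtranclp_trans)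
qed

lemma runs_within_Seq:
  assumes "runs_within c1 s t1" "\<And>s'. s' \<in> final_states c1 s \<Longrightarrow> runs_within c2 s' t2"
  shows "runs_within (Seq c1 c2) s (t1 + t2 + 1)"
  unfolding runs_within_def
proof (intro allI impI)
  fix k cfg assume "(step ^^ k) (Seq c1 c2, s) cfg"
  from steps_Seq[OF this] show "k \<le> t1 + t2 + 1"
  proof (elim disjE exE conjE)
    fix c1' s' assume "(step ^^ k) (c1, s) (c1', s')"
    then have "k \<le> t1" using assms(1) unfolding runs_within_def by blast
    then show ?thesis by simp
  next
    fix k1 s' k2
    assume *: "(step ^^ k1) (c1, s) (Skip, s')" "(step ^^ k2) (c2, s') cfg" "k = k1 + 1 + k2"
    then have "k1 \<le> t1" "k2 \<le> t2"
      using assms unfolding runs_within_def final_states_iff by blast+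
    then show ?thesis using * by simp
  qed
qed

text \<open>
  A longest step sequence ends in \<open>Skip\<close>, as every other configuration has a successor.
\<close>
lemma final_states_nonempty:
  "runs_within c s t \<Longrightarrow> final_states c s \<noteq> {}"
proof (induction t arbitrary: c s)
  case 0
  have "c = Skip"
  proof (rule ccontr)
    assume "c \<noteq> Skip"
    then obtain cfg where "step (c, s) cfg" using step_exists by blast
    then have "(step ^^ 1) (c, s) cfg" by (simp only: relpowp_1)
    then show False using 0 unfolding runs_within_def by (metis not_one_le_zero)
  qed
  then show ?case by (simp add: final_states_Skip)
next
  case (Suc t)
  show ?case
  proof (cases "c = Skip")
    case True
    then show ?thesis by (simp add: final_states_Skip)
  next
    case False
    then obtain c' s' where st: "step (c, s) (c', s')" using step_exists by (metis surj_pair)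
    have "runs_within c' s' t" unfolding runs_within_def
    proof (intro allI impI)
      fix k cfg assume "(step ^^ k) (c', s') cfg"
      then have "(step ^^ Suc k) (c, s) cfg" using st by (meson relpowp_Suc_I2)
      then show "k \<le> t" using Suc.prems unfolding runs_within_def by fastforce
    qed
    then show ?thesis using Suc.IH final_states_step[OF False] st by fastforce
  qed
qed

text \<open>
  The values in \<open>X\<close> are the abstract outcomes, and \<open>Q\<close> says what it means for a final state to represent
  one of them. That every execution represents some outcome, and that every outcome is represented by some
  execution, are kept in one judgement, so that both are established by one pass through a program.
\<close>
definition computes :: "com \<Rightarrow> state \<Rightarrow> nat \<Rightarrow> 'x set \<Rightarrow> ('x \<Rightarrow> state \<Rightarrow> bool) \<Rightarrow> bool" where
  "computes c s t X Q \<longleftrightarrow> runs_within c s t \<and>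
    (\<forall>s'\<in>final_states c s. \<exists>x\<in>X. Q x s') \<and> (\<forall>x\<in>X. \<exists>s'\<in>final_states c s. Q x s')"

text \<open>
  For deterministic code one outcome suffices, and then termination alone yields an execution that
  represents it (\<open>ensures_computes\<close>).
\<close>
definition ensures :: "com \<Rightarrow> state \<Rightarrow> nat \<Rightarrow> (state \<Rightarrow> bool) \<Rightarrow> bool" where
  "ensures c s t Q \<longleftrightarrow> runs_within c s t \<and> (\<forall>s'\<in>final_states c s. Q s')"

lemma ensures_computes:
  assumes "ensures c s t (Q x)"
  shows "computes c s t {x} Q"
proof -
  have "runs_within c s t" "\<forall>s'\<in>final_states c s. Q x s'" using assms unfolding ensures_def by auto
  moreover from this obtain s' where "s' \<in> final_states c s" using final_states_nonempty by blast
  ultimately show ?thesis unfolding computes_def by auto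
qed

lemma ensures_mono:
  "ensures c s t Q \<Longrightarrow> t \<le> t' \<Longrightarrow> (\<And>s'. Q s' \<Longrightarrow> Q' s') \<Longrightarrow> ensures c s t' Q'"
  unfolding ensures_def using runs_within_mono by blast

lemma computes_mono:
  "computes c s t X Q \<Longrightarrow> t \<le> t' \<Longrightarrow> (\<And>x s'. x \<in> X \<Longrightarrow> Q x s' \<Longrightarrow> Q' x s') \<Longrightarrow> computes c s t' X Q'"
  unfolding computes_def using runs_within_mono by blast

lemma computes_Seq:
  assumes c1: "computes c1 s t1 X Q"
    and c2: "\<And>x s'. x \<in> X \<Longrightarrow> Q x s' \<Longrightarrow> computes c2 s' t2 (Y x) R"
  shows "computes (Seq c1 c2) s (t1 + t2 + 1) (\<Union>x\<in>X. Y x) R"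
  unfolding computes_def final_states_Seq
proof (intro conjI ballI)
  have fwd: "\<exists>x\<in>X. computes c2 s' t2 (Y x) R" if "s' \<in> final_states c1 s" for s'
  proof -
    have "\<exists>x\<in>X. Q x s'" using c1 that unfolding computes_def by simp
    then show ?thesis using c2 by blast
  qed
  then show "runs_within (Seq c1 c2) s (t1 + t2 + 1)"
    using c1 unfolding computes_def by (intro runs_within_Seq) blast+
  fix s'' assume "s'' \<in> (\<Union>s'\<in>final_states c1 s. final_states c2 s')"
  then obtain s' where "s' \<in> final_states c1 s" "s'' \<in> final_states c2 s'" by blast
  with fwd obtain x where x: "x \<in> X" "computes c2 s' t2 (Y x) R" by blast
  then have "\<exists>y\<in>Y x. R y s''"
    using \<open>s'' \<in> final_states c2 s'\<close> unfolding computes_def by simp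
  then show "\<exists>y\<in>(\<Union>x\<in>X. Y x). R y s''" using x by blast
next
  fix y assume "y \<in> (\<Union>x\<in>X. Y x)"
  then obtain x where x: "x \<in> X" "y \<in> Y x" by blast
  then obtain s' where s': "s' \<in> final_states c1 s" "Q x s'"
    using c1 unfolding computes_def by blast
  then show "\<exists>s''\<in>(\<Union>s'\<in>final_states c1 s. final_states c2 s'). R y s''"
    using c2[OF x(1) s'(2)] x(2) unfolding computes_def by blast
qed

lemma ensures_Seq_computes:
  assumes "ensures c1 s t1 Q" and "\<And>s'. Q s' \<Longrightarrow> computes c2 s' t2 Y R"
  shows "computes (Seq c1 c2) s (t1 + t2 + 1) Y R"
proof -
  have "computes c1 s t1 {()} (\<lambda>_. Q)" using assms(1) by (rule ensures_computes)
  then have "computes (Seq c1 c2) s (t1 + t2 + 1) (\<Union>x\<in>{()}. Y) R"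
    by (rule computes_Seq) (rule assms(2))
  then show ?thesis by simp
qed

lemma ensures_Seq:
  assumes "ensures c1 s t1 Q" and "\<And>s'. Q s' \<Longrightarrow> ensures c2 s' t2 R"
  shows "ensures (Seq c1 c2) s (t1 + t2 + 1) R"
proof -
  have "runs_within (Seq c1 c2) s (t1 + t2 + 1)"
    using assms unfolding ensures_def by (intro runs_within_Seq) blast+
  then show ?thesis using assms unfolding ensures_def final_states_Seq by blast
qed

lemma ensures_Skip: "Q s \<Longrightarrow> ensures Skip s t Q"
  unfolding ensures_def by (simp add: runs_within_Skip final_states_Skip)

lemma ensures_Assign: "Q (set_reg x (aval a s) s) \<Longrightarrow> ensures (Assign x a) s 1 Q"
  unfolding ensures_def
  by (auto intro!: runs_within_step[of _ _ 0, simplified] simp: final_states_step final_states_Skip runs_within_Skip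
      elim!: step_AssignE)

lemma ensures_Write: "Q (set_arr A (aval a s) (aval b s) s) \<Longrightarrow> ensures (Write A a b) s 1 Q"
  unfolding ensures_def
  by (auto intro!: runs_within_step[of _ _ 0, simplified] simp: final_states_step final_states_Skip runs_within_Skip
      elim!: step_WriteE)

lemma computes_Choose: "computes (Choose x a) s 1 {..aval a s} (\<lambda>k s'. s' = set_reg x k s)"
proof -
  have "{cfg. step (Choose x a, s) cfg} = (\<lambda>k. (Skip, set_reg x k s)) ` {..aval a s}"
    by (auto elim!: step_ChooseE intro: step.Choose)
  then have "final_states (Choose x a) s = (\<lambda>k. set_reg x k s) ` {..aval a s}"
    by (auto simp: final_states_step final_states_Skip)
  moreover have "runs_within (Choose x a) s 1"
    by (auto intro!: runs_within_step[of _ _ 0, simplified] simp: runs_within_Skip elim!: step_ChooseE)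
  ultimately show ?thesis unfolding computes_def by auto
qed

lemma computes_image:
  assumes "computes c s t X Q" "\<And>x s'. x \<in> X \<Longrightarrow> Q x s' \<Longrightarrow> Q' (f x) s'"
  shows "computes c s t (f ` X) Q'"
  using assms unfolding computes_def by blast

lemma computes_Choose_Seq:
  assumes "\<And>k. k \<le> aval a s \<Longrightarrow> computes c (set_reg x k s) t (Y k) R"
  shows "computes (Seq (Choose x a) c) s (t + 2) (\<Union>k\<in>{..aval a s}. Y k) R"
proof -
  have "computes (Seq (Choose x a) c) s (1 + t + 1) (\<Union>k\<in>{..aval a s}. Y k) R"
    by (rule computes_Seq[OF computes_Choose]) (use assms in auto)
  then show ?thesis by simp
qed

lemma computes_change:
  assumes "computes c s t X Q"
    and "\<And>x s'. x \<in> X \<Longrightarrow> Q x s' \<Longrightarrow> \<exists>y\<in>Y. R y s'"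
    and "\<And>y. y \<in> Y \<Longrightarrow> \<exists>x\<in>X. \<forall>s'. Q x s' \<longrightarrow> R y s'"
  shows "computes c s t Y R"
  using assms unfolding computes_def by meson

lemma step_If: "{cfg. step (If b c1 c2, s) cfg} = {(if bval b s then c1 else c2, s)}"
  by (auto elim!: step_IfE intro: step.IfTrue step.IfFalse)

lemma ensures_If:
  assumes "bval b s \<Longrightarrow> ensures c1 s t Q" "\<not> bval b s \<Longrightarrow> ensures c2 s t Q"
  shows "ensures (If b c1 c2) s (Suc t) Q"
proof -
  have "runs_within (If b c1 c2) s (Suc t)"
    using assms unfolding ensures_def
    by (intro runs_within_step) (auto elim!: step_IfE)
  moreover have "final_states (If b c1 c2) s = final_states (if bval b s then c1 else c2) s"
    using step_If[of b c1 c2 s] by (simp add: final_states_step)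
  ultimately show ?thesis using assms unfolding ensures_def by auto
qed

lemma step_While: "{cfg. step (While b c, s) cfg} = {(if bval b s then Seq c (While b c) else Skip, s)}"
  by (auto elim!: step_WhileE intro: step.WhileTrue step.WhileFalse)

lemma computes_While:
  assumes "bval b s \<Longrightarrow> computes (Seq c (While b c)) s t X Q"
    and "\<not> bval b s \<Longrightarrow> computes Skip s t X Q"
  shows "computes (While b c) s (Suc t) X Q"
proof -
  have "runs_within (While b c) s (Suc t)"
    using assms unfolding computes_def
    by (intro runs_within_step) (auto elim!: step_WhileE)
  moreover have "final_states (While b c) s = final_states (if bval b s then Seq c (While b c) else Skip) s"
    using step_While[of b c s] by (simp add: final_states_step)
  ultimately show ?thesis using assms unfolding computes_def by auto
qed

lemma ensures_While:
  assumes "bval b s \<Longrightarrow> ensures (Seq c (While b c)) s t Q"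
    and "\<not> bval b s \<Longrightarrow> Q s"
  shows "ensures (While b c) s (Suc t) Q"
proof -
  have "runs_within (While b c) s (Suc t)"
    using assms unfolding ensures_def
    by (intro runs_within_step) (auto elim!: step_WhileE simp: runs_within_Skip)
  moreover have "final_states (While b c) s = final_states (if bval b s then Seq c (While b c) else Skip) s"
    using step_While[of b c s] by (simp add: final_states_step)
  ultimately show ?thesis using assms unfolding ensures_def by (auto simp: final_states_Skip)
qed

text \<open>
  Variables that a program cannot modify keep their values. The rules below supply this
  automatically, so that invariants need to mention only what changes.
\<close>
fun regs_of :: "com \<Rightarrow> string set" where
  "regs_of Skip = {}"
| "regs_of (Assign x a) = {x}"
| "regs_of (Write A a b) = {}"
| "regs_of (Choose x a) = {x}"
| "regs_of (Seq c1 c2) = regs_of c1 \<union> regs_of c2"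
| "regs_of (If b c1 c2) = regs_of c1 \<union> regs_of c2"
| "regs_of (While b c) = regs_of c"

fun arrs_of :: "com \<Rightarrow> string set" where
  "arrs_of Skip = {}"
| "arrs_of (Assign x a) = {}"
| "arrs_of (Write A a b) = {A}"
| "arrs_of (Choose x a) = {}"
| "arrs_of (Seq c1 c2) = arrs_of c1 \<union> arrs_of c2"
| "arrs_of (If b c1 c2) = arrs_of c1 \<union> arrs_of c2"
| "arrs_of (While b c) = arrs_of c"

definition agree :: "string set \<Rightarrow> string set \<Rightarrow> state \<Rightarrow> state \<Rightarrow> bool" where
  "agree W A s s' \<longleftrightarrow> (\<forall>x. x \<notin> W \<longrightarrow> reg s' x = reg s x) \<and> (\<forall>a. a \<notin> A \<longrightarrow> arr s' a = arr s a)"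

lemma agree_refl: "agree W A s s"
  unfolding agree_def by simp

lemma agree_trans:
  assumes "agree W A s s'" "agree W' A' s' s''" "W' \<subseteq> W" "A' \<subseteq> A"
  shows "agree W A s s''"
  unfolding agree_def
proof (intro conjI allI impI)
  show "reg s'' x = reg s x" if "x \<notin> W" for x
    using assms that unfolding agree_def by (metis subsetD)
  show "arr s'' a = arr s a" if "a \<notin> A" for a
    using assms that unfolding agree_def by (metis subsetD)
qed

lemma step_frame:
  "step (c, s) (c', s') \<Longrightarrow>
    agree (regs_of c) (arrs_of c) s s' \<and> regs_of c' \<subseteq> regs_of c \<and> arrs_of c' \<subseteq> arrs_of c"
proof (induction "(c, s)" "(c', s')" arbitrary: c s c' s' rule: step.induct)
  case (SeqStep c s c' s' c2)
  then show ?case using agree_trans[OF agree_refl SeqStep(2)[THEN conjunct1]] by auto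
qed (auto simp: agree_def)

lemma final_states_frame:
  assumes "s' \<in> final_states c s"
  shows "agree (regs_of c) (arrs_of c) s s'"
proof -
  have "step\<^sup>*\<^sup>* (c, s) (c', s') \<Longrightarrow>
      agree (regs_of c) (arrs_of c) s s' \<and> regs_of c' \<subseteq> regs_of c \<and> arrs_of c' \<subseteq> arrs_of c" for c'
  proof (induction rule: rtranclp_induct2)
    case refl
    show ?case by (simp add: agree_refl)
  next
    case (step c1 s1 c2 s2)
    then show ?case using step_frame[OF step(2)] agree_trans by (meson subset_trans)
  qed
  then show ?thesis using assms unfolding final_states_def by blast
qed

lemma computes_add_frame:
  "computes c s t X Q \<Longrightarrow> computes c s t X (\<lambda>x s'. Q x s' \<and> agree (regs_of c) (arrs_of c) s s')"
  unfolding computes_def using final_states_frame by blast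

lemma ensures_add_frame:
  "ensures c s t Q \<Longrightarrow> ensures c s t (\<lambda>s'. Q s' \<and> agree (regs_of c) (arrs_of c) s s')"
  unfolding ensures_def using final_states_frame by blast

text \<open>
  The upper limit of all loops is the number of edges, held by the register \<open>m\<close>.
\<close>
definition For :: "string \<Rightarrow> com \<Rightarrow> com" where
  "For x c = Seq (Assign x (Num 0))
    (While (Less (Reg x) (Reg ''m'')) (Seq c (Assign x (Plus (Reg x) (Num 1)))))"

lemma For_vars [simp]:
  "regs_of (For x c) = insert x (regs_of c)" "arrs_of (For x c) = arrs_of c"
  unfolding For_def by auto

text \<open>
  A bound for at most \<open>N\<close> passes through a body of cost \<open>t\<close>. Every pass takes four further steps: the test,
  the increment, and two that discard completed parts of a composition.
\<close>
definition loop_cost :: "nat \<Rightarrow> nat \<Rightarrow> nat" where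
  "loop_cost N t = N * (t + 4) + 4"

text \<open>
  The invariant refers to the loop counter through its first argument only; \<open>stable\<close> allows the
  increment to be absorbed.
\<close>
lemma ensures_For:
  assumes x: "x \<notin> regs_of c" "x \<noteq> ''m''" "''m'' \<notin> regs_of c" and N: "reg s0 ''m'' \<le> N"
    and body: "\<And>i s. i < reg s0 ''m'' \<Longrightarrow> agree (insert x (regs_of c)) (arrs_of c) s0 s \<Longrightarrow>
      reg s x = i \<Longrightarrow> I i s \<Longrightarrow> ensures c s t (I (Suc i))"
    and stable: "\<And>i k s. I i s \<Longrightarrow> I i (set_reg x k s)"
    and start: "I 0 s0"
    and final: "\<And>s. I (reg s0 ''m'') s \<Longrightarrow> agree (insert x (regs_of c)) (arrs_of c) s0 s \<Longrightarrow> Q s"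
  shows "ensures (For x c) s0 (loop_cost N t) Q"
proof -
  let ?Q = "\<lambda>s. I (reg s0 ''m'') s \<and> agree (insert x (regs_of c)) (arrs_of c) s0 s"
  let ?m = "reg s0 ''m''"
  let ?body = "Seq c (Assign x (Plus (Reg x) (Num 1)))"
  let ?ag = "agree (insert x (regs_of c)) (arrs_of c) s0"
  have loop: "ensures (While (Less (Reg x) (Reg ''m'')) ?body) s ((?m - i) * (t + 4) + 1) ?Q"
    if "i \<le> ?m" "?ag s" "reg s x = i" "I i s" for i s
    using that
  proof (induction "?m - i" arbitrary: i s)
    case 0
    then have "i = ?m" "reg s ''m'' = ?m" using x unfolding agree_def by auto
    then have "ensures (While (Less (Reg x) (Reg ''m'')) ?body) s (Suc 0) ?Q"
      using 0(3-5) by (intro ensures_While) simp_all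
    then show ?case by (rule ensures_mono) simp_all
  next
    case (Suc n)
    have lt: "i < ?m" using Suc(2) by linarith
    have "ensures c s t (\<lambda>s'. I (Suc i) s' \<and> agree (regs_of c) (arrs_of c) s s')"
      using body[OF lt Suc.prems(2-4)] by (rule ensures_add_frame)
    then have "ensures ?body s (t + 1 + 1)
        (\<lambda>s'. I (Suc i) s' \<and> ?ag s' \<and> reg s' x = Suc i)"
    proof (rule ensures_Seq, intro ensures_Assign)
      fix s' assume "I (Suc i) s' \<and> agree (regs_of c) (arrs_of c) s s'"
      then have s': "I (Suc i) s'" "agree (regs_of c) (arrs_of c) s s'" by auto
      have "?ag s'" using agree_trans[OF Suc.prems(2) s'(2)] by blast
      then have "?ag (set_reg x k s')" for k unfolding agree_def by auto
      moreover have "reg s' x = i" using s'(2) x(1) Suc.prems(3) unfolding agree_def by simp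
      ultimately show "I (Suc i) (set_reg x (aval (Plus (Reg x) (Num 1)) s') s') \<and>
          ?ag (set_reg x (aval (Plus (Reg x) (Num 1)) s') s') \<and>
          reg (set_reg x (aval (Plus (Reg x) (Num 1)) s') s') x = Suc i"
        using stable[OF s'(1)] by simp
    qed
    then have "ensures (Seq ?body (While (Less (Reg x) (Reg ''m'')) ?body)) s
        ((t + 1 + 1) + ((?m - Suc i) * (t + 4) + 1) + 1) ?Q"
      by (rule ensures_Seq) (use Suc(1)[of "Suc i"] Suc(2) lt in auto)
    then have "ensures (While (Less (Reg x) (Reg ''m'')) ?body) s
        (Suc ((t + 1 + 1) + ((?m - Suc i) * (t + 4) + 1) + 1)) ?Q"
    proof (rule ensures_While)
      assume "\<not> bval (Less (Reg x) (Reg ''m'')) s"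
      then show "?Q s" using lt Suc.prems(2,3) x unfolding agree_def by simp
    qed
    moreover have "?m - i = Suc (?m - Suc i)" using lt by simp
    ultimately show ?case by (elim ensures_mono) auto
  qed
  have "ensures (For x c) s0 (1 + (?m * (t + 4) + 1) + 1) ?Q"
    unfolding For_def
  proof (rule ensures_Seq[OF ensures_Assign, where Q = "\<lambda>s. ?ag s \<and> reg s x = 0 \<and> I 0 s"])
    show "?ag (set_reg x (aval (Num 0) s0) s0) \<and> reg (set_reg x (aval (Num 0) s0) s0) x = 0 \<and>
        I 0 (set_reg x (aval (Num 0) s0) s0)"
      using start stable unfolding agree_def by auto
  qed (use loop[of 0] in auto)
  moreover have "?m * (t + 4) \<le> N * (t + 4)" using N by (rule mult_le_mono1)
  then have "1 + (?m * (t + 4) + 1) + 1 \<le> loop_cost N t" unfolding loop_cost_def by linarith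
  ultimately show ?thesis by (rule ensures_mono) (use final in blast)
qed

text \<open>
  Code without loops and choices is executed symbolically by the simplifier.
\<close>
fun straight :: "com \<Rightarrow> bool" where
  "straight (Seq c1 c2) = (straight c1 \<and> straight c2)"
| "straight (If b c1 c2) = (straight c1 \<and> straight c2)"
| "straight (While b c) = False"
| "straight (Choose x a) = False"
| "straight _ = True"

fun effect :: "com \<Rightarrow> state \<Rightarrow> state" where
  "effect (Assign x a) s = set_reg x (aval a s) s"
| "effect (Write A a b) s = set_arr A (aval a s) (aval b s) s"
| "effect (Seq c1 c2) s = effect c2 (effect c1 s)"
| "effect (If b c1 c2) s = (if bval b s then effect c1 s else effect c2 s)"
| "effect _ s = s"

fun cost :: "com \<Rightarrow> nat" where
  "cost (Seq c1 c2) = cost c1 + cost c2 + 1"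
| "cost (If b c1 c2) = Suc (max (cost c1) (cost c2))"
| "cost _ = 1"

lemma ensures_straight:
  "straight c \<Longrightarrow> Q (effect c s) \<Longrightarrow> ensures c s (cost c) Q"
proof (induction c arbitrary: s Q)
  case (Seq c1 c2)
  then have "ensures c1 s (cost c1) (\<lambda>s'. s' = effect c1 s)" by simp
  moreover have "ensures c2 (effect c1 s) (cost c2) Q" using Seq by simp
  ultimately show ?case using ensures_Seq[of c1 s "cost c1" "\<lambda>s'. s' = effect c1 s" c2 "cost c2" Q] by simp
next
  case (If b c1 c2)
  have "ensures c1 s (max (cost c1) (cost c2)) Q" if "bval b s"
    using If that by (intro ensures_mono[OF If.IH(1)[of Q s]]) auto
  moreover have "ensures c2 s (max (cost c1) (cost c2)) Q" if "\<not> bval b s"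
    using If that by (intro ensures_mono[OF If.IH(2)[of Q s]]) auto
  ultimately show ?case by (simp add: ensures_If)
qed (auto intro: ensures_Assign[simplified] ensures_Write[simplified] ensures_Skip)

section \<open>Local Search on positions in the edge list\<close>

text \<open>
  From here on, sets of edges of an input graph are represented by sets of positions in its edge list.
\<close>
definition picked :: "(nat \<times> nat) list \<Rightarrow> nat set \<Rightarrow> nat set set" where
  "picked es X = (\<lambda>i. edge_of (es ! i)) ` X"

definition meet :: "(nat \<times> nat) list \<Rightarrow> nat \<Rightarrow> nat \<Rightarrow> bool" where
  "meet es i j \<longleftrightarrow> edge_of (es ! i) \<inter> edge_of (es ! j) \<noteq> {}"

definition unlinked :: "(nat \<times> nat) list \<Rightarrow> nat set \<Rightarrow> bool" where
  "unlinked es X \<longleftrightarrow>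
    (\<forall>i\<in>X. \<forall>j\<in>X. i \<noteq> j \<longrightarrow> (\<forall>l<length es. \<not> (meet es l i \<and> meet es l j)))"

text \<open>
  One triple describes a move of either kind. As \<open>a\<close> is removed before \<open>b\<close> and \<open>c\<close> are
  inserted, the triple \<open>(a, a, a)\<close> with \<open>a \<notin> X\<close> stands for the addition of \<open>a\<close>.
\<close>
fun exchange :: "nat set \<Rightarrow> nat \<times> nat \<times> nat \<Rightarrow> nat set" where
  "exchange X (a, b, c) = insert c (insert b (X - {a}))"

type_synonym guard = "nat set \<Rightarrow> nat \<times> nat \<times> nat \<Rightarrow> bool"

fun add_guard :: guard where
  "add_guard X (a, b, c) \<longleftrightarrow> a \<notin> X \<and> a = b \<and> b = c"

fun swap_guard :: guard where
  "swap_guard X (a, b, c) \<longleftrightarrow> a \<in> X \<and> b \<notin> X \<and> c \<notin> X \<and> b \<noteq> c"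

definition candidates :: "(nat \<times> nat) list \<Rightarrow> guard \<Rightarrow> nat set \<Rightarrow> (nat \<times> nat \<times> nat) set" where
  "candidates es G X = {\<tau> \<in> {..<length es} \<times> {..<length es} \<times> {..<length es}.
     G X \<tau> \<and> unlinked es (exchange X \<tau>)}"

definition results :: "(nat \<times> nat) list \<Rightarrow> guard \<Rightarrow> nat set \<Rightarrow> nat set set" where
  "results es G X = (if candidates es G X = {} then {X} else exchange X ` candidates es G X)"

lemma graph_input_inj:
  assumes "graph_input n es"
  shows "inj_on (\<lambda>i. edge_of (es ! i)) {..<length es}"
  using assms unfolding graph_input_def
  by (auto simp: inj_on_def distinct_conv_nth)

lemma edges_of_picked: "edges_of es = picked es {..<length es}"
  unfolding edges_of_def picked_def set_conv_nth by blast

lemma picked_mem_iff: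
  assumes g: "graph_input n es" and X: "X \<subseteq> {..<length es}" and i: "i < length es"
  shows "edge_of (es ! i) \<in> picked es X \<longleftrightarrow> i \<in> X"
  unfolding picked_def using inj_on_image_mem_iff[OF graph_input_inj[OF g] _ X] i by blast

lemma picked_insert: "picked es (insert i X) = insert (edge_of (es ! i)) (picked es X)"
  unfolding picked_def by simp

lemma picked_remove:
  assumes "graph_input n es" "X \<subseteq> {..<length es}" "i < length es"
  shows "picked es (X - {i}) = picked es X - {edge_of (es ! i)}"
proof -
  have "X - {i} \<subseteq> {..<length es}" "{i} \<subseteq> {..<length es}" using assms(2,3) by auto
  from inj_on_image_set_diff[OF graph_input_inj[OF assms(1)] this] show ?thesis
    unfolding picked_def by simp
qed

lemma card_picked:
  assumes "graph_input n es" "X \<subseteq> {..<length es}"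
  shows "card (picked es X) = card X"
  unfolding picked_def using card_image inj_on_subset[OF graph_input_inj[OF assms(1)] assms(2)] by blast

lemma induced_matching_picked:
  assumes g: "graph_input n es" and X: "X \<subseteq> {..<length es}"
  shows "induced_matching (edges_of es) (picked es X) \<longleftrightarrow> unlinked es X"
proof -
  have fg: "fin_graph {..<n} (edges_of es)" using g unfolding graph_input_def by blast
  have sub: "picked es X \<subseteq> edges_of es" using X unfolding edges_of_picked picked_def by blast
  have link: "linked (edges_of es) e f \<longleftrightarrow>
      (\<exists>l<length es. edge_of (es ! l) \<inter> e \<noteq> {} \<and> edge_of (es ! l) \<inter> f \<noteq> {})" for e f
    unfolding linked_def edges_of_picked picked_def by blast
  have neq: "edge_of (es ! i) = edge_of (es ! j) \<longleftrightarrow> i = j" if "i \<in> X" "j \<in> X" for i j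
    using inj_onD[OF graph_input_inj[OF g]] that X by blast
  show ?thesis
    unfolding induced_matching_iff_unlinked[OF fg] link unlinked_def meet_def picked_def
    using sub neq unfolding picked_def by auto
qed

lemma exchange_bounded: "X \<subseteq> {..<m} \<Longrightarrow> \<tau> \<in> {..<m} \<times> {..<m} \<times> {..<m} \<Longrightarrow> exchange X \<tau> \<subseteq> {..<m}"
  by (cases \<tau>) auto

lemma results_bounded: "X \<subseteq> {..<length es} \<Longrightarrow> Y \<in> results es G X \<Longrightarrow> Y \<subseteq> {..<length es}"
  unfolding results_def candidates_def
  using exchange_bounded[of X "length es"] by (auto split: if_splits)

lemma picked_exchange:
  assumes "graph_input n es" "X \<subseteq> {..<length es}" "a < length es"
  shows "picked es (exchange X (a, b, c)) =
    insert (edge_of (es ! c)) (insert (edge_of (es ! b)) (picked es X - {edge_of (es ! a)}))"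
  by (simp add: picked_insert picked_remove[OF assms])

lemma add_move_picked:
  assumes g: "graph_input n es" and X: "X \<subseteq> {..<length es}"
  shows "add_move (edges_of es) (picked es X) M' \<longleftrightarrow>
    M' \<in> picked es ` exchange X ` candidates es add_guard X" (is "?L \<longleftrightarrow> ?R")
proof
  assume ?L
  then obtain i where i: "i < length es" "edge_of (es ! i) \<notin> picked es X"
    "M' = picked es X \<union> {edge_of (es ! i)}" "induced_matching (edges_of es) M'"
    unfolding add_move_def edges_of_picked[of es] picked_def[of es "{..<length es}"] by blast
  then have "i \<notin> X" using picked_mem_iff[OF g X] by blast
  then have ex: "exchange X (i, i, i) = insert i X" by auto
  have M': "M' = picked es (insert i X)" using i by (simp add: picked_insert)
  have "unlinked es (insert i X)"
    using i(4) induced_matching_picked[OF g, of "insert i X"] X i(1) unfolding M' by simp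
  then have "(i, i, i) \<in> candidates es add_guard X"
    unfolding candidates_def using i(1) \<open>i \<notin> X\<close> ex by simp
  then show ?R unfolding M' using ex by (metis imageI)
next
  assume ?R
  then obtain i where i: "i < length es" "i \<notin> X" "unlinked es (insert i X)" "M' = picked es (insert i X)"
    unfolding candidates_def by (auto simp: insert_absorb)
  then have "M' = picked es X \<union> {edge_of (es ! i)}" by (simp add: picked_insert)
  moreover have "edge_of (es ! i) \<in> edges_of es - picked es X"
    using picked_mem_iff[OF g X i(1)] i(1,2) unfolding edges_of_def by simp
  moreover have "induced_matching (edges_of es) M'"
    using induced_matching_picked[OF g, of "insert i X"] i X by simp
  ultimately show ?L unfolding add_move_def by blast
qed

lemma swap_move_picked:
  assumes g: "graph_input n es" and X: "X \<subseteq> {..<length es}"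
  shows "swap_move (edges_of es) (picked es X) M' \<longleftrightarrow>
    M' \<in> picked es ` exchange X ` candidates es swap_guard X" (is "?L \<longleftrightarrow> ?R")
proof
  assume ?L
  then obtain e e' e'' where e: "e \<in> picked es X" "e' \<in> edges_of es - picked es X"
    "e'' \<in> edges_of es - picked es X" "e' \<noteq> e''" "M' = (picked es X - {e}) \<union> {e', e''}"
    "induced_matching (edges_of es) M'"
    unfolding swap_move_def by blast
  obtain a where a: "a \<in> X" "e = edge_of (es ! a)" using e(1) unfolding picked_def by blast
  obtain b c where bc: "b < length es" "e' = edge_of (es ! b)" "c < length es" "e'' = edge_of (es ! c)"
    using e(2,3) unfolding edges_of_picked picked_def by blast
  have am: "a < length es" using a X by blast
  have nbc: "b \<notin> X" "c \<notin> X" "b \<noteq> c" using e(2-4) bc picked_mem_iff[OF g X] by auto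
  have M': "M' = picked es (exchange X (a, b, c))"
    unfolding picked_exchange[OF g X am] using e(5) a bc by blast
  have "exchange X (a, b, c) \<subseteq> {..<length es}" using X am bc by auto
  then have "unlinked es (exchange X (a, b, c))"
    using e(6) induced_matching_picked[OF g] unfolding M' by blast
  then have "(a, b, c) \<in> candidates es swap_guard X"
    unfolding candidates_def using am bc a(1) nbc by simp
  then show ?R unfolding M' by blast
next
  assume ?R
  then obtain a b c where m: "a < length es" "b < length es" "c < length es"
    and guard: "a \<in> X" "b \<notin> X" "c \<notin> X" "b \<noteq> c"
    and un: "unlinked es (exchange X (a, b, c))" and M': "M' = picked es (exchange X (a, b, c))"
    unfolding candidates_def by auto
  have "exchange X (a, b, c) \<subseteq> {..<length es}" using X m by auto
  then have "induced_matching (edges_of es) M'"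
    using un induced_matching_picked[OF g] unfolding M' by blast
  moreover have "edge_of (es ! b) \<noteq> edge_of (es ! c)"
    using inj_onD[OF graph_input_inj[OF g]] m guard(4) by blast
  moreover have "edge_of (es ! b) \<in> edges_of es - picked es X" "edge_of (es ! c) \<in> edges_of es - picked es X"
    using picked_mem_iff[OF g X] m guard unfolding edges_of_def by auto
  moreover have "edge_of (es ! a) \<in> picked es X" using guard(1) unfolding picked_def by blast
  moreover have "M' = (picked es X - {edge_of (es ! a)}) \<union> {edge_of (es ! b), edge_of (es ! c)}"
    unfolding M' picked_exchange[OF g X m(1)] by blast
  ultimately show ?L unfolding swap_move_def by blast
qed

lemma if_possible_results:
  assumes "\<And>M'. R (picked es X) M' \<longleftrightarrow> M' \<in> picked es ` exchange X ` candidates es G X"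
  shows "if_possible R (picked es X) M' \<longleftrightarrow> M' \<in> picked es ` results es G X"
  unfolding if_possible_def results_def assms by auto

lemma iteration_picked:
  assumes g: "graph_input n es" and X: "X \<subseteq> {..<length es}"
  shows "iteration (edges_of es) (picked es X) M' \<longleftrightarrow>
    M' \<in> picked es ` (\<Union>Y\<in>results es add_guard X. results es swap_guard Y)"
proof -
  have "if_possible (add_move (edges_of es)) (picked es X) M \<longleftrightarrow>
      M \<in> picked es ` results es add_guard X" for M
    using add_move_picked[OF g X] by (rule if_possible_results)
  moreover have "if_possible (swap_move (edges_of es)) (picked es Y) M' \<longleftrightarrow>
      M' \<in> picked es ` results es swap_guard Y" if "Y \<in> results es add_guard X" for Y
    using swap_move_picked[OF g results_bounded[OF X that]] by (rule if_possible_results)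
  ultimately show ?thesis unfolding iteration_def OO_def by auto
qed

lemma card_exchange:
  assumes "finite X"
  shows "add_guard X \<tau> \<Longrightarrow> card (exchange X \<tau>) = Suc (card X)"
    and "swap_guard X \<tau> \<Longrightarrow> card (exchange X \<tau>) = Suc (card X)"
proof -
  obtain a b c where \<tau>: "\<tau> = (a, b, c)" by (cases \<tau>)
  show "card (exchange X \<tau>) = Suc (card X)" if "add_guard X \<tau>"
    using that assms unfolding \<tau> by auto
  show "card (exchange X \<tau>) = Suc (card X)" if "swap_guard X \<tau>"
  proof -
    have "card X > 0" using that assms unfolding \<tau> by (auto simp: card_gt_0_iff)
    then show ?thesis using that assms unfolding \<tau> by (auto simp: card_insert_if)
  qed
qed

lemma local_search_run_unfold:
  "local_search_run E M Ms \<longleftrightarrow> (\<exists>M'. iteration E M M' \<and>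
    (if card M < card M' then \<exists>Ms'. local_search_run E M' Ms' \<and> Ms = M' # Ms' else Ms = [M']))"
  by (subst local_search_run.simps) auto

section \<open>A program for Local Search\<close>

definition Eq :: "aexp \<Rightarrow> aexp \<Rightarrow> bexp" where
  "Eq a b = And (Not (Less a b)) (Not (Less b a))"

definition Or :: "bexp \<Rightarrow> bexp \<Rightarrow> bexp" where
  "Or p q = Not (And (Not p) (Not q))"

lemma bval_Eq [simp]: "bval (Eq a b) s \<longleftrightarrow> aval a s = aval b s"
  unfolding Eq_def by auto

lemma bval_Or [simp]: "bval (Or p q) s \<longleftrightarrow> bval p s \<or> bval q s"
  unfolding Or_def by simp

lemma agree_reg: "agree W A s s' \<Longrightarrow> x \<notin> W \<Longrightarrow> reg s' x = reg s x"
  unfolding agree_def by blast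

lemma agree_arr: "agree W A s s' \<Longrightarrow> a \<notin> A \<Longrightarrow> arr s' a = arr s a"
  unfolding agree_def by blast

lemma agree_subset: "agree W A s s' \<Longrightarrow> W \<subseteq> W' \<Longrightarrow> A \<subseteq> A' \<Longrightarrow> agree W' A' s s'"
  unfolding agree_def by blast

definition stores :: "(nat \<times> nat) list \<Rightarrow> state \<Rightarrow> bool" where
  "stores es s \<longleftrightarrow> reg s ''m'' = length es \<and>
    (\<forall>i<length es. arr s ''U'' i = fst (es ! i) \<and> arr s ''V'' i = snd (es ! i))"

lemma stores_agree:
  "stores es s \<Longrightarrow> agree W A s s' \<Longrightarrow> ''m'' \<notin> W \<Longrightarrow> ''U'' \<notin> A \<Longrightarrow> ''V'' \<notin> A \<Longrightarrow> stores es s'"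
  unfolding stores_def by (simp add: agree_reg agree_arr)

definition entries :: "string \<Rightarrow> nat \<Rightarrow> state \<Rightarrow> nat set" where
  "entries A m s = {i. i < m \<and> arr s A i \<noteq> 0}"

definition Meet :: "string \<Rightarrow> string \<Rightarrow> bexp" where
  "Meet x y =
    Or (Or (Eq (Read ''U'' (Reg x)) (Read ''U'' (Reg y))) (Eq (Read ''U'' (Reg x)) (Read ''V'' (Reg y))))
       (Or (Eq (Read ''V'' (Reg x)) (Read ''U'' (Reg y))) (Eq (Read ''V'' (Reg x)) (Read ''V'' (Reg y))))"

lemma bval_Meet:
  assumes "stores es s" "reg s x < length es" "reg s y < length es"
  shows "bval (Meet x y) s \<longleftrightarrow> meet es (reg s x) (reg s y)"
proof -
  have e: "edge_of p = {fst p, snd p}" for p by (cases p) simp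
  show ?thesis using assms unfolding Meet_def meet_def stores_def e by auto
qed

text \<open>
  The edge at position \<open>l\<close> shows that the entries \<open>i\<close> and \<open>j\<close> of the array \<open>D\<close> are linked.
\<close>
definition clash :: "bexp" where
  "clash = And (And (Less (Num 0) (Read ''D'' (Reg ''i''))) (Less (Num 0) (Read ''D'' (Reg ''j''))))
    (And (Not (Eq (Reg ''i'') (Reg ''j''))) (And (Meet ''l'' ''i'') (Meet ''l'' ''j'')))"

definition check_body :: com where
  "check_body = If clash (Assign ''r'' (Num 0)) Skip"

definition check :: com where
  "check = Seq (Assign ''r'' (Num 1)) (For ''i'' (For ''j'' (For ''l'' check_body)))"

lemma check_body_vars [simp]: "regs_of check_body = {''r''}" "arrs_of check_body = {}"
  unfolding check_body_def by auto

lemma check_vars [simp]: "regs_of check = {''r'', ''i'', ''j'', ''l''}" "arrs_of check = {}"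
  unfolding check_def by auto

text \<open>
  A loop whose body resets the flag \<open>r\<close> when its condition fails computes a bounded universal
  quantifier. Nested uses evaluate the definition of \<open>unlinked\<close>.
\<close>
lemma forall_loop:
  assumes x: "x \<notin> regs_of c" "x \<noteq> ''m''" "''m'' \<notin> regs_of c" "x \<noteq> ''r''" and N: "reg s0 ''m'' \<le> N"
    and body: "\<And>i s. i < reg s0 ''m'' \<Longrightarrow> agree (insert x (regs_of c)) (arrs_of c) s0 s \<Longrightarrow>
      reg s x = i \<Longrightarrow> ensures c s t (\<lambda>s'. reg s' ''r'' \<noteq> 0 \<longleftrightarrow> reg s ''r'' \<noteq> 0 \<and> P i)"
  shows "ensures (For x c) s0 (loop_cost N t)
    (\<lambda>s. reg s ''r'' \<noteq> 0 \<longleftrightarrow> reg s0 ''r'' \<noteq> 0 \<and> (\<forall>i<reg s0 ''m''. P i))"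
proof -
  let ?I = "\<lambda>i s. reg s ''r'' \<noteq> 0 \<longleftrightarrow> reg s0 ''r'' \<noteq> 0 \<and> (\<forall>i'<i. P i')"
  show ?thesis
  proof (rule ensures_For[where I = ?I, OF x(1-3) N])
    fix i s assume "i < reg s0 ''m''" "agree (insert x (regs_of c)) (arrs_of c) s0 s"
      "reg s x = i" and I: "?I i s"
    from body[OF this(1-3)] show "ensures c s t (?I (Suc i))"
    proof (rule ensures_mono)
      fix s' assume "reg s' ''r'' \<noteq> 0 \<longleftrightarrow> reg s ''r'' \<noteq> 0 \<and> P i"
      then show "?I (Suc i) s'" using I less_Suc_eq by auto
    qed simp
  qed (use x in auto)
qed

definition check_cost :: "nat \<Rightarrow> nat" where
  "check_cost N = loop_cost N (loop_cost N (loop_cost N (cost check_body))) + 2"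

lemma check_correct:
  assumes st: "stores es s" and N: "length es \<le> N"
  shows "ensures check s (check_cost N) (\<lambda>s'. reg s' ''r'' \<noteq> 0 \<longleftrightarrow> unlinked es (entries ''D'' (length es) s))"
proof -
  let ?m = "length es"
  let ?X = "entries ''D'' ?m s"
  let ?P = "\<lambda>i j l. \<not> (i \<in> ?X \<and> j \<in> ?X \<and> i \<noteq> j \<and> meet es l i \<and> meet es l j)"
  have m: "reg s' ''m'' = ?m" if "agree {''r'', ''i'', ''j'', ''l''} {} s s'" for s'
    using st that unfolding stores_def by (simp add: agree_reg)
  have loops: "ensures (For ''i'' (For ''j'' (For ''l'' check_body))) s1
      (loop_cost N (loop_cost N (loop_cost N (cost check_body))))
      (\<lambda>s'. reg s' ''r'' \<noteq> 0 \<longleftrightarrow> reg s1 ''r'' \<noteq> 0 \<and> (\<forall>i<reg s1 ''m''. \<forall>j<?m. \<forall>l<?m. ?P i j l))"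
    if s1: "agree {''r''} {} s s1" for s1
  proof (rule forall_loop, goal_cases)
    case (6 i s2)
    have s2: "agree {''r'', ''i'', ''j'', ''l''} {} s s2"
      by (rule agree_trans[OF agree_subset[OF s1] 6(2)]) auto
    have "ensures (For ''j'' (For ''l'' check_body)) s2
      (loop_cost N (loop_cost N (cost check_body)))
      (\<lambda>s'. reg s' ''r'' \<noteq> 0 \<longleftrightarrow> reg s2 ''r'' \<noteq> 0 \<and> (\<forall>j<reg s2 ''m''. \<forall>l<?m. ?P i j l))"
    proof (rule forall_loop, goal_cases)
      case (6 j s3)
      have s3: "agree {''r'', ''i'', ''j'', ''l''} {} s s3"
        by (rule agree_trans[OF s2 6(2)]) auto
      have i3: "reg s3 ''i'' = i" using agree_reg[OF 6(2)] \<open>reg s2 ''i'' = i\<close> by simp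
      have "ensures (For ''l'' check_body) s3
        (loop_cost N (cost check_body))
        (\<lambda>s'. reg s' ''r'' \<noteq> 0 \<longleftrightarrow> reg s3 ''r'' \<noteq> 0 \<and> (\<forall>l<reg s3 ''m''. ?P i j l))"
      proof (rule forall_loop, goal_cases)
        case (6 l s4)
        have s4: "agree {''r'', ''i'', ''j'', ''l''} {} s s4"
          by (rule agree_trans[OF s3 6(2)]) auto
        have regs: "reg s4 ''i'' = i" "reg s4 ''j'' = j" "reg s4 ''l'' = l"
          using agree_reg[OF 6(2)] i3 \<open>reg s3 ''j'' = j\<close> \<open>reg s4 ''l'' = l\<close> by simp_all
        have lt: "i < ?m" "j < ?m" "l < ?m"
          using \<open>i < reg s1 ''m''\<close> \<open>j < reg s2 ''m''\<close> \<open>l < reg s3 ''m''\<close> m s2 s3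
            m[OF agree_subset[OF s1]] by auto
        have "stores es s4" by (rule stores_agree[OF st s4]) auto
        then have "bval (Meet ''l'' ''i'') s4 \<longleftrightarrow> meet es l i" "bval (Meet ''l'' ''j'') s4 \<longleftrightarrow> meet es l j"
          using bval_Meet[of es s4] regs lt by simp_all
        moreover have "arr s4 ''D'' = arr s ''D''" using s4 by (simp add: agree_arr)
        ultimately have "bval clash s4 \<longleftrightarrow> \<not> ?P i j l"
          unfolding clash_def entries_def using regs lt by auto
        then show ?case by (intro ensures_straight) (auto simp: check_body_def)
      qed (use m[OF s3] N in auto)
      then show ?case using m[OF s3] by simp
    qed (use m[OF s2] N in auto)
    then show ?case using m[OF s2] by simp
  qed (use m[OF agree_subset[OF s1]] N in auto)
  have "ensures check s (1 + loop_cost N (loop_cost N (loop_cost N (cost check_body))) + 1)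
      (\<lambda>s'. reg s' ''r'' \<noteq> 0 \<longleftrightarrow> (\<forall>i<?m. \<forall>j<?m. \<forall>l<?m. ?P i j l))"
    unfolding check_def
  proof (intro ensures_Seq[OF ensures_Assign, where Q = "\<lambda>s1. agree {''r''} {} s s1 \<and> reg s1 ''r'' \<noteq> 0"], goal_cases)
    case 1
    then show ?case by (simp add: agree_def)
  next
    case (2 s1)
    then have "reg s1 ''m'' = ?m" using m[OF agree_subset[of _ _ s s1]] by auto
    with 2 show ?case by (intro ensures_mono[OF loops[of s1]]) auto
  qed
  then show ?thesis
  proof (rule ensures_mono)
    have "(\<forall>i<?m. \<forall>j<?m. \<forall>l<?m. ?P i j l) \<longleftrightarrow> unlinked es ?X"
      unfolding unlinked_def entries_def by blast
    then show "reg s' ''r'' \<noteq> 0 \<longleftrightarrow> unlinked es ?X"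
      if "reg s' ''r'' \<noteq> 0 \<longleftrightarrow> (\<forall>i<?m. \<forall>j<?m. \<forall>l<?m. ?P i j l)" for s'
      using that by simp
  qed (simp add: check_cost_def)
qed

definition copy :: "string \<Rightarrow> aexp \<Rightarrow> string \<Rightarrow> com" where
  "copy A k B = For ''h'' (Write A (Plus k (Reg ''h'')) (Read B (Reg ''h'')))"

lemma copy_vars [simp]: "regs_of (copy A k B) = {''h''}" "arrs_of (copy A k B) = {A}"
  unfolding copy_def by auto

lemma copy_correct:
  assumes AB: "A \<noteq> B" and N: "reg s ''m'' \<le> N"
    and k: "\<And>s'. agree {''h''} {A} s s' \<Longrightarrow> aval k s' = aval k s"
  shows "ensures (copy A k B) s (loop_cost N 1) (\<lambda>s'. arr s' A = (\<lambda>i.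
    if aval k s \<le> i \<and> i < aval k s + reg s ''m'' then arr s B (i - aval k s) else arr s A i))"
proof -
  let ?I = "\<lambda>h s'. arr s' A = (\<lambda>i.
    if aval k s \<le> i \<and> i < aval k s + h then arr s B (i - aval k s) else arr s A i)"
  let ?c = "Write A (Plus k (Reg ''h'')) (Read B (Reg ''h''))"
  show ?thesis unfolding copy_def
  proof (rule ensures_For[where I = ?I, OF _ _ _ N])
    fix i s' assume "agree (insert ''h'' (regs_of ?c)) (arrs_of ?c) s s'" "reg s' ''h'' = i" "?I i s'"
    then show "ensures ?c s' 1 (?I (Suc i))"
      using k[of s'] AB agree_arr[of "{''h''}" "{A}" s s' B]
      by (intro ensures_Write) auto
  qed auto
qed


text \<open>
  The legal triple just found, \<open>(a, b, c)\<close>, is recorded in \<open>(a1, b1, c1)\<close> if it is the first one (\<open>f\<close> is still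
  zero) or equals the triple \<open>(a0, b0, c0)\<close> chosen in advance.
\<close>
definition select :: com where
  "select = If (And (Less (Num 0) (Reg ''r'')) (Or (Eq (Reg ''f'') (Num 0))
      (And (Eq (Reg ''a'') (Reg ''a0'')) (And (Eq (Reg ''b'') (Reg ''b0'')) (Eq (Reg ''c'') (Reg ''c0''))))))
    (Seq (Assign ''f'' (Num 1)) (Seq (Assign ''a1'' (Reg ''a''))
      (Seq (Assign ''b1'' (Reg ''b'')) (Assign ''c1'' (Reg ''c'')))))
    Skip"

definition modify :: "string \<Rightarrow> aexp \<Rightarrow> aexp \<Rightarrow> aexp \<Rightarrow> com" where
  "modify A a b c = Seq (Write A a (Num 0)) (Seq (Write A b (Num 1)) (Write A c (Num 1)))"

text \<open>
  The exchange is performed on a copy \<open>D\<close> of the current matching \<open>C\<close>.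
\<close>
definition try_candidate :: "bexp \<Rightarrow> com" where
  "try_candidate g = If g
    (Seq (copy ''D'' (Num 0) ''C'')
      (Seq (modify ''D'' (Reg ''a'') (Reg ''b'') (Reg ''c'')) (Seq check select)))
    Skip"

lemma try_vars [simp]:
  "regs_of select = {''f'', ''a1'', ''b1'', ''c1''}" "arrs_of select = {}"
  "regs_of (modify A a b c) = {}" "arrs_of (modify A a b c) = {A}"
  "regs_of (try_candidate g) = {''h'', ''r'', ''i'', ''j'', ''l'', ''f'', ''a1'', ''b1'', ''c1''}"
  "arrs_of (try_candidate g) = {''D''}"
  unfolding select_def modify_def try_candidate_def by auto

definition add_test :: bexp where
  "add_test = And (Eq (Read ''C'' (Reg ''a'')) (Num 0))
    (And (Eq (Reg ''a'') (Reg ''b'')) (Eq (Reg ''b'') (Reg ''c'')))"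

definition swap_test :: bexp where
  "swap_test = And (Less (Num 0) (Read ''C'' (Reg ''a'')))
    (And (And (Eq (Read ''C'' (Reg ''b'')) (Num 0)) (Eq (Read ''C'' (Reg ''c'')) (Num 0)))
      (Not (Eq (Reg ''b'') (Reg ''c''))))"

definition decides :: "(nat \<times> nat) list \<Rightarrow> bexp \<Rightarrow> guard \<Rightarrow> bool" where
  "decides es g G \<longleftrightarrow> (\<forall>s. reg s ''a'' < length es \<longrightarrow> reg s ''b'' < length es \<longrightarrow> reg s ''c'' < length es \<longrightarrow>
    (bval g s \<longleftrightarrow> G (entries ''C'' (length es) s) (reg s ''a'', reg s ''b'', reg s ''c'')))"

lemma decides_add: "decides es add_test add_guard"
  unfolding decides_def add_test_def entries_def by auto

lemma decides_swap: "decides es swap_test swap_guard"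
  unfolding decides_def swap_test_def entries_def by auto

lemma entries_modify:
  assumes "aval a s < m" "\<And>A i k. aval b (set_arr A i k s) = aval b s" "\<And>A i k s. aval c (set_arr A i k s) = aval c s"
    "aval b s < m" "aval c s < m"
  shows "entries A m (effect (modify A a b c) s) = exchange (entries A m s) (aval a s, aval b s, aval c s)"
  using assms unfolding modify_def entries_def by auto

lemma straight_modify [simp]: "straight (modify A a b c)"
  unfolding modify_def by simp

lemma cost_modify [simp]: "cost (modify A a b c) = 5"
  unfolding modify_def by simp

definition best :: "state \<Rightarrow> nat \<times> nat \<times> nat" where
  "best s = (reg s ''a1'', reg s ''b1'', reg s ''c1'')"

text \<open>
  The state of the search through the set \<open>K\<close> of legal triples after the triples in \<open>S\<close> have been tried:
  \<open>\<tau>\<close> is the triple chosen in advance, \<open>f\<close> the flag and \<open>\<beta>\<close> the recorded triple.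
\<close>
definition scanned :: "('x \<times> 'y \<times> 'z) set \<Rightarrow> ('x \<times> 'y \<times> 'z) \<Rightarrow> ('x \<times> 'y \<times> 'z) set \<Rightarrow> nat \<Rightarrow> ('x \<times> 'y \<times> 'z) \<Rightarrow> bool" where
  "scanned K \<tau> S f \<beta> \<longleftrightarrow>
    (if K \<inter> S = {} then f = 0 else f \<noteq> 0 \<and> \<beta> \<in> K \<and> (\<tau> \<in> K \<inter> S \<longrightarrow> \<beta> = \<tau>))"

lemma scanned_insert:
  assumes "scanned K \<tau> S f \<beta>"
  shows "scanned K \<tau> (insert \<sigma> S) (if \<sigma> \<in> K \<and> (f = 0 \<or> \<sigma> = \<tau>) then 1 else f)
    (if \<sigma> \<in> K \<and> (f = 0 \<or> \<sigma> = \<tau>) then \<sigma> else \<beta>)"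
  using assms unfolding scanned_def by (cases "\<sigma> \<in> K"; cases "K \<inter> S = {}"; cases "\<sigma> = \<tau>") auto

definition try_cost :: "nat \<Rightarrow> nat" where
  "try_cost N = loop_cost N 1 + check_cost N + cost select + 10"

lemma try_candidate_correct:
  assumes st: "stores es s" and N: "length es \<le> N" and g: "decides es g G"
    and abc: "reg s ''a'' < length es" "reg s ''b'' < length es" "reg s ''c'' < length es"
    and X: "entries ''C'' (length es) s = X"
    and sc: "scanned (candidates es G X) (reg s ''a0'', reg s ''b0'', reg s ''c0'') S (reg s ''f'') (best s)"
  shows "ensures (try_candidate g) s (try_cost N)
    (\<lambda>s'. scanned (candidates es G X) (reg s ''a0'', reg s ''b0'', reg s ''c0'')
      (insert (reg s ''a'', reg s ''b'', reg s ''c'') S) (reg s' ''f'') (best s'))"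
    (is "ensures _ _ _ ?Q")
proof -
  let ?m = "length es"
  let ?\<sigma> = "(reg s ''a'', reg s ''b'', reg s ''c'')"
  let ?K = "candidates es G X"
  have m: "reg s ''m'' = ?m" using st unfolding stores_def by simp
  have in_K: "?\<sigma> \<in> ?K \<longleftrightarrow> bval g s \<and> unlinked es (exchange X ?\<sigma>)"
    using g abc X unfolding candidates_def decides_def by auto
  have "ensures (Seq (copy ''D'' (Num 0) ''C'')
      (Seq (modify ''D'' (Reg ''a'') (Reg ''b'') (Reg ''c'')) (Seq check select))) s
      (loop_cost N 1 + (5 + (check_cost N + cost select + 1) + 1) + 1) ?Q" if bg: "bval g s"
  proof (rule ensures_Seq)
    show "ensures (copy ''D'' (Num 0) ''C'') s (loop_cost N 1)
        (\<lambda>s1. entries ''D'' ?m s1 = X \<and> agree {''h''} {''D''} s s1)"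
      by (rule ensures_mono[OF ensures_add_frame[OF copy_correct[where N = N]]])
        (use m N X in \<open>auto simp: entries_def\<close>)
    fix s1 assume "entries ''D'' ?m s1 = X \<and> agree {''h''} {''D''} s s1"
    then have s1: "entries ''D'' ?m s1 = X" "agree {''h''} {''D''} s s1" by auto
    show "ensures (Seq (modify ''D'' (Reg ''a'') (Reg ''b'') (Reg ''c'')) (Seq check select)) s1
        (5 + (check_cost N + cost select + 1) + 1) ?Q"
    proof (rule ensures_Seq)
      have "entries ''D'' ?m (effect (modify ''D'' (Reg ''a'') (Reg ''b'') (Reg ''c'')) s1) = exchange X ?\<sigma>"
        using entries_modify[of "Reg ''a''" s1 ?m "Reg ''b''" "Reg ''c''" "''D''"] s1 abc
        by (simp add: agree_reg)
      then have "ensures (modify ''D'' (Reg ''a'') (Reg ''b'') (Reg ''c'')) s1 5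
          (\<lambda>s2. entries ''D'' ?m s2 = exchange X ?\<sigma>)"
        using ensures_straight[of "modify ''D'' (Reg ''a'') (Reg ''b'') (Reg ''c'')"] by simp
      then show "ensures (modify ''D'' (Reg ''a'') (Reg ''b'') (Reg ''c'')) s1 5
          (\<lambda>s2. entries ''D'' ?m s2 = exchange X ?\<sigma> \<and> agree {} {''D''} s1 s2)"
        by (rule ensures_add_frame[THEN ensures_mono]) auto
      fix s2 assume s2: "entries ''D'' ?m s2 = exchange X ?\<sigma> \<and> agree {} {''D''} s1 s2"
      have ag2: "agree {''h''} {''D''} s s2"
        by (rule agree_trans[OF s1(2) conjunct2[OF s2]]) auto
      have st2: "stores es s2" by (rule stores_agree[OF st ag2]) auto
      show "ensures (Seq check select) s2 (check_cost N + cost select + 1) ?Q"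
      proof (rule ensures_Seq)
        show "ensures check s2 (check_cost N) (\<lambda>s3. (reg s3 ''r'' \<noteq> 0 \<longleftrightarrow> unlinked es (exchange X ?\<sigma>)) \<and>
            agree {''r'', ''i'', ''j'', ''l''} {} s2 s3)"
          by (rule ensures_add_frame[OF check_correct[OF st2 N], THEN ensures_mono]) (use s2 in auto)
        fix s3 assume s3: "(reg s3 ''r'' \<noteq> 0 \<longleftrightarrow> unlinked es (exchange X ?\<sigma>)) \<and>
            agree {''r'', ''i'', ''j'', ''l''} {} s2 s3"
        have ag3: "agree {''h'', ''r'', ''i'', ''j'', ''l''} {''D''} s s3"
          by (rule agree_trans[OF agree_subset[OF ag2] conjunct2[OF s3]]) auto
        have r: "reg s3 ''r'' \<noteq> 0 \<longleftrightarrow> ?\<sigma> \<in> ?K" using s3 in_K bg by simp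
        have same: "reg s3 ''a'' = reg s ''a''"
          "reg s3 ''b'' = reg s ''b''"
          "reg s3 ''c'' = reg s ''c''"
          "reg s3 ''a0'' = reg s ''a0''"
          "reg s3 ''b0'' = reg s ''b0''"
          "reg s3 ''c0'' = reg s ''c0''"
          "reg s3 ''a1'' = reg s ''a1''"
          "reg s3 ''b1'' = reg s ''b1''"
          "reg s3 ''c1'' = reg s ''c1''"
          "reg s3 ''f'' = reg s ''f''"
          by (simp_all add: agree_reg[OF ag3])
        let ?\<tau> = "(reg s ''a0'', reg s ''b0'', reg s ''c0'')"
        define take_it where "take_it \<longleftrightarrow> ?\<sigma> \<in> ?K \<and> (reg s ''f'' = 0 \<or> ?\<sigma> = ?\<tau>)"
        have bv: "bval (And (Less (Num 0) (Reg ''r'')) (Or (Eq (Reg ''f'') (Num 0))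
            (And (Eq (Reg ''a'') (Reg ''a0'')) (And (Eq (Reg ''b'') (Reg ''b0'')) (Eq (Reg ''c'') (Reg ''c0'')))))) s3
          \<longleftrightarrow> take_it"
          using r unfolding take_it_def by (simp add: same)
        have "reg (effect select s3) ''f'' = (if take_it then 1 else reg s ''f'')"
          "best (effect select s3) = (if take_it then ?\<sigma> else best s)"
          unfolding select_def effect.simps bv by (simp_all add: same best_def)
        then have "?Q (effect select s3)"
          using scanned_insert[OF sc, of ?\<sigma>] unfolding take_it_def by (simp only:)
        then show "ensures select s3 (cost select) ?Q"
          by (intro ensures_straight) (simp_all add: select_def)
      qed
    qed
  qed
  moreover have "?Q s" if "\<not> bval g s"
    using sc in_K that unfolding scanned_def by simp
  ultimately have "ensures (try_candidate g) s
      (Suc (loop_cost N 1 + (5 + (check_cost N + cost select + 1) + 1) + 1)) ?Q"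
    unfolding try_candidate_def by (intro ensures_If) (auto intro: ensures_Skip)
  then show ?thesis by (rule ensures_mono) (simp_all add: try_cost_def)
qed

definition scan :: "bexp \<Rightarrow> com" where
  "scan g = For ''a'' (For ''b'' (For ''c'' (try_candidate g)))"

definition scan_cost :: "nat \<Rightarrow> nat" where
  "scan_cost N = loop_cost N (loop_cost N (loop_cost N (try_cost N)))"

abbreviation "scan_regs \<equiv> {''a'', ''b'', ''c'', ''h'', ''r'', ''i'', ''j'', ''l'', ''f'', ''a1'', ''b1'', ''c1''}"

lemma scan_vars [simp]: "regs_of (scan g) = scan_regs" "arrs_of (scan g) = {''D''}"
  unfolding scan_def by auto

lemma scan_correct:
  assumes st: "stores es s" and N: "length es \<le> N" and g: "decides es g G"
    and X: "entries ''C'' (length es) s = X" and f: "reg s ''f'' = 0"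
  shows "ensures (scan g) s (scan_cost N)
    (\<lambda>s'. scanned (candidates es G X) (reg s ''a0'', reg s ''b0'', reg s ''c0'')
      ({..<length es} \<times> {..<length es} \<times> {..<length es}) (reg s' ''f'') (best s'))"
proof -
  let ?m = "length es"
  let ?sc = "\<lambda>S s'. scanned (candidates es G X) (reg s ''a0'', reg s ''b0'', reg s ''c0'') S (reg s' ''f'') (best s')"
  let ?ag = "agree scan_regs {''D''} s"
  have ag_st: "stores es s'" if "?ag s'" for s' by (rule stores_agree[OF st that]) auto
  then have m: "reg s' ''m'' = ?m" if "?ag s'" for s' using that unfolding stores_def by simp
  have "ensures (scan g) s (scan_cost N) (\<lambda>s'. ?sc ({..<reg s ''m''} \<times> {..<?m} \<times> {..<?m}) s')"
    unfolding scan_def scan_cost_def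
  proof (rule ensures_For[where N = N and I = "\<lambda>i. ?sc ({..<i} \<times> {..<?m} \<times> {..<?m})"], goal_cases)
    case (5 a sa)
    have ga: "?ag sa" by (rule agree_subset[OF 5(2)]) auto
    have "ensures (For ''b'' (For ''c'' (try_candidate g))) sa (loop_cost N (loop_cost N (try_cost N)))
        (\<lambda>s'. ?sc ({..<a} \<times> {..<?m} \<times> {..<?m} \<union> {a} \<times> {..<reg sa ''m''} \<times> {..<?m}) s')"
    proof (rule ensures_For[where N = N and
          I = "\<lambda>i. ?sc ({..<a} \<times> {..<?m} \<times> {..<?m} \<union> {a} \<times> {..<i} \<times> {..<?m})"], goal_cases)
      case (5 b sb)
      have gb: "?ag sb" by (rule agree_trans[OF ga 5(2)]) auto
      have a: "reg sb ''a'' = a" using agree_reg[OF 5(2)] \<open>reg sa ''a'' = a\<close> by simp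
      let ?S = "{..<a} \<times> {..<?m} \<times> {..<?m} \<union> {a} \<times> {..<b} \<times> {..<?m}"
      have "ensures (For ''c'' (try_candidate g)) sb (loop_cost N (try_cost N))
          (\<lambda>s'. ?sc (?S \<union> {a} \<times> {b} \<times> {..<reg sb ''m''}) s')"
      proof (rule ensures_For[where N = N and I = "\<lambda>i. ?sc (?S \<union> {a} \<times> {b} \<times> {..<i})"], goal_cases)
        case (5 c sc)
        have gc: "?ag sc" by (rule agree_trans[OF gb 5(2)]) auto
        have abc: "reg sc ''a'' = a" "reg sc ''b'' = b" "reg sc ''c'' = c"
          using agree_reg[OF 5(2)] a \<open>reg sb ''b'' = b\<close> \<open>reg sc ''c'' = c\<close> by simp_all
        have lt: "a < ?m" "b < ?m" "c < ?m"
          using \<open>a < reg s ''m''\<close> \<open>b < reg sa ''m''\<close> \<open>c < reg sb ''m''\<close> m ga gb m[OF agree_refl] by auto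
        have tgt: "reg sc ''a0'' = reg s ''a0''" "reg sc ''b0'' = reg s ''b0''" "reg sc ''c0'' = reg s ''c0''"
          using agree_reg[OF gc] by simp_all
        have "entries ''C'' ?m sc = X"
          using agree_arr[OF gc, of "''C''"] X unfolding entries_def by simp
        from try_candidate_correct[OF ag_st[OF gc] N g _ _ _ this, of "?S \<union> {a} \<times> {b} \<times> {..<c}"]
        have "ensures (try_candidate g) sc (try_cost N) (?sc (insert (a, b, c) (?S \<union> {a} \<times> {b} \<times> {..<c})))"
          using abc lt tgt 5(4) by simp
        moreover have "insert (a, b, c) (?S \<union> {a} \<times> {b} \<times> {..<c}) = ?S \<union> {a} \<times> {b} \<times> {..<Suc c}"
          by auto
        ultimately show ?case by simp
      qed (use m[OF gb] N 5(4) in \<open>auto simp: best_def\<close>)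
      moreover have "?S \<union> {a} \<times> {b} \<times> {..<?m} = {..<a} \<times> {..<?m} \<times> {..<?m} \<union> {a} \<times> {..<Suc b} \<times> {..<?m}"
        by auto
      ultimately show ?case using m[OF gb] by simp
    qed (use m[OF ga] N 5(4) in \<open>auto simp: best_def\<close>)
    moreover have "{..<a} \<times> {..<?m} \<times> {..<?m} \<union> {a} \<times> {..<?m} \<times> {..<?m} = {..<Suc a} \<times> {..<?m} \<times> {..<?m}"
      by auto
    ultimately show ?case using m[OF ga] by simp
  qed (use m[OF agree_refl] N f in \<open>auto simp: best_def scanned_def\<close>)
  then show ?thesis using m[OF agree_refl] by simp
qed


definition commit :: com where
  "commit = If (Less (Num 0) (Reg ''f''))
    (Seq (modify ''C'' (Reg ''a1'') (Reg ''b1'') (Reg ''c1'')) (Assign ''g'' (Num 1))) Skip"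

definition settle :: "bexp \<Rightarrow> com" where
  "settle g = Seq (Assign ''f'' (Num 0)) (Seq (scan g) commit)"

text \<open>
  The values that can be chosen include the number of edges, which is not a position. A triple that
  contains it is never legal and leaves the selection to the scan.
\<close>
definition phase :: "bexp \<Rightarrow> com" where
  "phase g = Seq (Choose ''a0'' (Reg ''m'')) (Seq (Choose ''b0'' (Reg ''m''))
    (Seq (Choose ''c0'' (Reg ''m'')) (settle g)))"

lemma phase_vars [simp]:
  "regs_of commit = {''g''}" "arrs_of commit = {''C''}"
  "regs_of (phase g) = {''a0'', ''b0'', ''c0'', ''g''} \<union> scan_regs" "arrs_of (phase g) = {''C'', ''D''}"
  unfolding commit_def phase_def settle_def by auto

definition settle_cost :: "nat \<Rightarrow> nat" where
  "settle_cost N = scan_cost N + cost commit + 3"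

lemma settle_correct:
  assumes st: "stores es s" and N: "length es \<le> N" and g: "decides es g G"
    and X: "entries ''C'' (length es) s = X"
    and K_def: "K = candidates es G X" and \<tau>_def: "\<tau> = (reg s ''a0'', reg s ''b0'', reg s ''c0'')"
  shows "ensures (settle g) s (settle_cost N) (\<lambda>s'.
    if K = {} then entries ''C'' (length es) s' = X \<and> reg s' ''g'' = reg s ''g''
    else (\<exists>\<sigma>\<in>K. (\<tau> \<in> K \<longrightarrow> \<sigma> = \<tau>) \<and> entries ''C'' (length es) s' = exchange X \<sigma>) \<and> reg s' ''g'' = 1)"
    (is "ensures _ _ _ ?Q")
proof -
  let ?m = "length es"
  let ?all = "{..<?m} \<times> {..<?m} \<times> {..<?m}"
  have K_all: "K \<inter> ?all = K" unfolding K_def candidates_def by auto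
  have "ensures (settle g) s (1 + (scan_cost N + cost commit + 1) + 1) ?Q"
    unfolding settle_def
  proof (rule ensures_Seq[OF ensures_Assign])
    show "set_reg ''f'' (aval (Num 0) s) s = set_reg ''f'' 0 s" by simp
    fix s1 assume s1: "s1 = set_reg ''f'' 0 s"
    have "stores es s1" using st unfolding s1 stores_def by simp
    moreover have "entries ''C'' ?m s1 = X" using X unfolding s1 entries_def by simp
    moreover have "reg s1 ''f'' = 0" unfolding s1 by simp
    ultimately have "ensures (scan g) s1 (scan_cost N)
        (\<lambda>s'. scanned K \<tau> ?all (reg s' ''f'') (best s') \<and> agree (regs_of (scan g)) (arrs_of (scan g)) s1 s')"
      using ensures_add_frame[OF scan_correct[OF _ N g, of s1 X]]
      unfolding K_def \<tau>_def s1 by simp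
    then show "ensures (Seq (scan g) commit) s1 (scan_cost N + cost commit + 1) ?Q"
    proof (rule ensures_Seq)
      fix s2 assume "scanned K \<tau> ?all (reg s2 ''f'') (best s2) \<and> agree (regs_of (scan g)) (arrs_of (scan g)) s1 s2"
      then have sc: "scanned K \<tau> ?all (reg s2 ''f'') (best s2)" and ag: "agree scan_regs {''D''} s1 s2" by auto
      have C2: "entries ''C'' ?m s2 = X"
        using agree_arr[OF ag, of "''C''"] X unfolding s1 entries_def by simp
      have g2: "reg s2 ''g'' = reg s ''g''" using agree_reg[OF ag, of "''g''"] unfolding s1 by simp
      have "?Q (effect commit s2)"
      proof (cases "K = {}")
        case True
        then have "reg s2 ''f'' = 0" using sc unfolding scanned_def by simp
        then show ?thesis using True C2 g2 unfolding commit_def by simp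
      next
        case False
        then have f: "reg s2 ''f'' \<noteq> 0" and b: "best s2 \<in> K" "\<tau> \<in> K \<longrightarrow> best s2 = \<tau>"
          using sc K_all unfolding scanned_def by auto
        let ?mod = "modify ''C'' (Reg ''a1'') (Reg ''b1'') (Reg ''c1'')"
        have "best s2 \<in> ?all" using b(1) K_all by blast
        then have "entries ''C'' ?m (effect ?mod s2) = exchange X (best s2)"
          using entries_modify[of "Reg ''a1''" s2 ?m "Reg ''b1''" "Reg ''c1''" "''C''"] C2
          unfolding best_def by simp
        moreover have "effect commit s2 = set_reg ''g'' 1 (effect ?mod s2)"
          using f unfolding commit_def by simp
        ultimately have "entries ''C'' ?m (effect commit s2) = exchange X (best s2)" "reg (effect commit s2) ''g'' = 1"
          unfolding entries_def by simp_all
        then show ?thesis using False b by auto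
      qed
      then show "ensures commit s2 (cost commit) ?Q"
        by (intro ensures_straight) (simp_all add: commit_def)
    qed
  qed
  then show ?thesis by (rule ensures_mono) (simp_all add: settle_cost_def)
qed

definition phase_cost :: "nat \<Rightarrow> nat" where
  "phase_cost N = settle_cost N + 6"

text \<open>
  If there are legal triples, every final state comes from a recorded one, and each of them is
  recorded in the executions that choose it in advance. Otherwise all choices leave the matching unchanged.
\<close>
lemma phase_correct:
  assumes st: "stores es s" and N: "length es \<le> N" and g: "decides es g G"
    and X: "entries ''C'' (length es) s = X"
  defines "K \<equiv> candidates es G X"
  shows "computes (phase g) s (phase_cost N) (results es G X)
    (\<lambda>Y s'. entries ''C'' (length es) s' = Y \<and> reg s' ''g'' = (if K = {} then reg s ''g'' else 1))"
    (is "computes _ _ _ _ ?R")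
proof -
  let ?m = "length es"
  let ?Q = "\<lambda>\<tau> s'.
    if K = {} then entries ''C'' ?m s' = X \<and> reg s' ''g'' = reg s ''g''
    else (\<exists>\<sigma>\<in>K. (\<tau> \<in> K \<longrightarrow> \<sigma> = \<tau>) \<and> entries ''C'' ?m s' = exchange X \<sigma>) \<and> reg s' ''g'' = 1"
  have m: "reg s ''m'' = ?m" using st unfolding stores_def by simp
  have settle: "computes (settle g) (set_reg ''c0'' c (set_reg ''b0'' b (set_reg ''a0'' a s))) (settle_cost N) {(a, b, c)} ?Q" for a b c
  proof (rule ensures_computes)
    let ?s = "set_reg ''c0'' c (set_reg ''b0'' b (set_reg ''a0'' a s))"
    have "stores es ?s" using st unfolding stores_def by simp
    moreover have "entries ''C'' ?m ?s = X" using X unfolding entries_def by simp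
    moreover have "(a, b, c) = (reg ?s ''a0'', reg ?s ''b0'', reg ?s ''c0'')" by simp
    ultimately have "ensures (settle g) ?s (settle_cost N) (\<lambda>s'.
        if K = {} then entries ''C'' ?m s' = X \<and> reg s' ''g'' = reg ?s ''g''
        else (\<exists>\<sigma>\<in>K. ((a, b, c) \<in> K \<longrightarrow> \<sigma> = (a, b, c)) \<and> entries ''C'' ?m s' = exchange X \<sigma>) \<and> reg s' ''g'' = 1)"
      unfolding K_def by (intro settle_correct[OF _ N g _ refl])
    moreover have "reg ?s ''g'' = reg s ''g''" by simp
    ultimately show "ensures (settle g) ?s (settle_cost N) (?Q (a, b, c))" by (simp only:)
  qed
  have "computes (phase g) s (settle_cost N + 2 + 2 + 2)
      (\<Union>a\<in>{..aval (Reg ''m'') s}. \<Union>b\<in>{..aval (Reg ''m'') (set_reg ''a0'' a s)}.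
        \<Union>c\<in>{..aval (Reg ''m'') (set_reg ''b0'' b (set_reg ''a0'' a s))}. {(a, b, c)}) ?Q"
    unfolding phase_def by (intro computes_Choose_Seq settle)
  moreover have "(\<Union>a\<in>{..aval (Reg ''m'') s}. \<Union>b\<in>{..aval (Reg ''m'') (set_reg ''a0'' a s)}.
        \<Union>c\<in>{..aval (Reg ''m'') (set_reg ''b0'' b (set_reg ''a0'' a s))}. {(a, b, c)}) = {..?m} \<times> {..?m} \<times> {..?m}"
    using m by auto
  ultimately have "computes (phase g) s (phase_cost N) ({..?m} \<times> {..?m} \<times> {..?m}) ?Q"
    unfolding phase_cost_def by (simp add: numeral_eq_Suc)
  then show ?thesis
  proof (rule computes_change)
    fix \<tau> s' assume "?Q \<tau> s'"
    then show "\<exists>Y\<in>results es G X. ?R Y s'"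
      unfolding results_def K_def by (cases "candidates es G X = {}") auto
  next
    fix Y assume Y: "Y \<in> results es G X"
    show "\<exists>\<tau>\<in>{..?m} \<times> {..?m} \<times> {..?m}. \<forall>s'. ?Q \<tau> s' \<longrightarrow> ?R Y s'"
    proof (cases "K = {}")
      case True
      then have "Y = X" using Y unfolding results_def K_def by simp
      then show ?thesis using True by (intro bexI[of _ "(0, 0, 0)"]) auto
    next
      case False
      then obtain \<tau> where \<tau>: "\<tau> \<in> K" "Y = exchange X \<tau>" using Y unfolding results_def K_def by auto
      then have "\<tau> \<in> {..?m} \<times> {..?m} \<times> {..?m}" unfolding K_def candidates_def by auto
      then show ?thesis using False \<tau> by (intro bexI[of _ \<tau>]) auto
    qed
  qed
qed

definition search_round :: com where
  "search_round = Seq (Assign ''g'' (Num 0)) (Seq (phase add_test) (Seq (phase swap_test)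
    (Seq (copy ''M'' (Reg ''o'') ''C'')
      (Seq (Assign ''o'' (Plus (Reg ''o'') (Reg ''m''))) (Assign ''k'' (Plus (Reg ''k'') (Num 1)))))))"

definition local_search_program :: com where
  "local_search_program = Seq (Assign ''g'' (Num 1)) (While (Less (Num 0) (Reg ''g'')) search_round)"

text \<open>
  The register \<open>o\<close> holds the position in the array \<open>M\<close> at which the next row begins.
\<close>
definition tracks :: "(nat \<times> nat) list \<Rightarrow> nat set \<Rightarrow> nat set set list \<Rightarrow> state \<Rightarrow> bool" where
  "tracks es X Ms s \<longleftrightarrow> stores es s \<and> entries ''C'' (length es) s = X \<and>
    reg s ''o'' = reg s ''k'' * length es \<and> output_run es s = Ms"

lemma tracks_frame:
  assumes "tracks es X Ms s" "agree W A s s'" "''m'' \<notin> W" "''o'' \<notin> W" "''k'' \<notin> W" "''U'' \<notin> A" "''V'' \<notin> A" "''M'' \<notin> A"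
  shows "tracks es (entries ''C'' (length es) s') Ms s'"
  using assms stores_agree[of es s W A s']
  unfolding tracks_def output_run_def by (simp add: agree_reg agree_arr)

definition round_cost :: "nat \<Rightarrow> nat" where
  "round_cost N = 2 * phase_cost N + loop_cost N 1 + 8"

lemma record_row:
  assumes N: "length es \<le> N" and s: "tracks es X Ms s"
  shows "ensures (Seq (copy ''M'' (Reg ''o'') ''C'')
      (Seq (Assign ''o'' (Plus (Reg ''o'') (Reg ''m''))) (Assign ''k'' (Plus (Reg ''k'') (Num 1)))))
    s (loop_cost N 1 + 3 + 1) (\<lambda>s'. tracks es X (Ms @ [picked es X]) s' \<and> reg s' ''g'' = reg s ''g'')"
proof (rule ensures_Seq)
  let ?m = "length es" and ?k = "reg s ''k''"
  have m: "reg s ''m'' = ?m" and o: "reg s ''o'' = ?k * ?m"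
    using s unfolding tracks_def stores_def by auto
  show "ensures (copy ''M'' (Reg ''o'') ''C'') s (loop_cost N 1)
      (\<lambda>s1. arr s1 ''M'' = (\<lambda>i. if ?k * ?m \<le> i \<and> i < ?k * ?m + ?m then arr s ''C'' (i - ?k * ?m) else arr s ''M'' i) \<and>
        agree {''h''} {''M''} s s1)"
    by (rule ensures_mono[OF ensures_add_frame[OF copy_correct[where N = N]]])
      (use m N o in \<open>auto simp: agree_reg\<close>)
  fix s1 assume s1: "arr s1 ''M'' = (\<lambda>i. if ?k * ?m \<le> i \<and> i < ?k * ?m + ?m then arr s ''C'' (i - ?k * ?m) else arr s ''M'' i) \<and>
        agree {''h''} {''M''} s s1"
  let ?c = "Seq (Assign ''o'' (Plus (Reg ''o'') (Reg ''m''))) (Assign ''k'' (Plus (Reg ''k'') (Num 1)))"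
  let ?s = "effect ?c s1"
  have regs: "reg s1 ''o'' = ?k * ?m" "reg s1 ''k'' = ?k" "reg s1 ''m'' = ?m" "reg s1 ''g'' = reg s ''g''"
    using s1 o m by (auto simp: agree_reg)
  have old: "arr s1 ''M'' (t * ?m + j) = arr s ''M'' (t * ?m + j)" if "t < ?k" "j < ?m" for t j
  proof -
    have "t * ?m + j < Suc t * ?m" using that by simp
    also have "\<dots> \<le> ?k * ?m" using that by (intro mult_le_mono1) simp
    finally show ?thesis using s1 by simp
  qed
  have new: "arr s1 ''M'' (?k * ?m + j) = arr s ''C'' j" if "j < ?m" for j
    using that s1 by simp
  have "output_run es ?s = map (\<lambda>t. {edge_of (es ! j) | j. j < ?m \<and> arr s1 ''M'' (t * ?m + j) \<noteq> 0}) [0..<Suc ?k]"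
    unfolding output_run_def using regs by simp
  also have "\<dots> = output_run es s @ [{edge_of (es ! j) | j. j < ?m \<and> arr s ''C'' j \<noteq> 0}]"
    unfolding output_run_def using old new by (auto intro!: map_cong Collect_cong)
  also have "{edge_of (es ! j) | j. j < ?m \<and> arr s ''C'' j \<noteq> 0} = picked es X"
    using s unfolding tracks_def entries_def picked_def by auto
  finally have "output_run es ?s = Ms @ [picked es X]" using s unfolding tracks_def by simp
  moreover have "stores es ?s"
    using stores_agree[of es s "{''h''}" "{''M''}" s1] s s1 unfolding tracks_def by (simp add: stores_def)
  moreover have "entries ''C'' ?m ?s = X"
    using s agree_arr[OF conjunct2[OF s1], of "''C''"] unfolding tracks_def entries_def by simp
  ultimately have "tracks es X (Ms @ [picked es X]) ?s \<and> reg ?s ''g'' = reg s ''g''"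
    unfolding tracks_def using regs by simp
  then show "ensures ?c s1 3 (\<lambda>s'. tracks es X (Ms @ [picked es X]) s' \<and> reg s' ''g'' = reg s ''g'')"
    using ensures_straight[of ?c] by (simp add: numeral_eq_Suc)
qed


text \<open>
  For this reason the flag \<open>g\<close>, which is set whenever a move is performed, tells whether the matching
  has grown.
\<close>
lemma card_results:
  assumes "finite X" "Y \<in> results es G X" "G = add_guard \<or> G = swap_guard"
  shows "card Y = (if candidates es G X = {} then card X else Suc (card X))"
  using assms card_exchange[OF assms(1)] unfolding results_def candidates_def by (auto split: if_splits)

lemma round_correct:
  assumes N: "length es \<le> N" and s: "tracks es X Ms s"
  shows "computes search_round s (round_cost N) (\<Union>Y\<in>results es add_guard X. results es swap_guard Y)
    (\<lambda>Z s'. tracks es Z (Ms @ [picked es Z]) s' \<and> (reg s' ''g'' \<noteq> 0 \<longleftrightarrow> card X < card Z))"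
    (is "computes _ _ _ _ ?R")
proof -
  let ?m = "length es"
  have X: "X \<subseteq> {..<?m}" using s unfolding tracks_def entries_def by auto
  have "computes search_round s (1 + (phase_cost N + (phase_cost N + (loop_cost N 1 + 3 + 1) + 1) + 1) + 1)
      (\<Union>Y\<in>results es add_guard X. \<Union>Z\<in>results es swap_guard Y. {Z}) ?R"
    unfolding search_round_def
  proof (rule ensures_Seq_computes[OF ensures_Assign])
    show "set_reg ''g'' (aval (Num 0) s) s = set_reg ''g'' 0 s" by simp
    fix s1 assume s1: "s1 = set_reg ''g'' 0 s"
    have t1: "tracks es X Ms s1" using s unfolding s1 tracks_def stores_def entries_def output_run_def by simp
    then have st1: "stores es s1" and X1: "entries ''C'' ?m s1 = X" unfolding tracks_def by auto
    show "computes (Seq (phase add_test) (Seq (phase swap_test)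
        (Seq (copy ''M'' (Reg ''o'') ''C'')
          (Seq (Assign ''o'' (Plus (Reg ''o'') (Reg ''m''))) (Assign ''k'' (Plus (Reg ''k'') (Num 1)))))))
      s1 (phase_cost N + (phase_cost N + (loop_cost N 1 + 3 + 1) + 1) + 1)
      (\<Union>Y\<in>results es add_guard X. \<Union>Z\<in>results es swap_guard Y. {Z}) ?R"
    proof (rule computes_Seq[OF computes_add_frame[OF phase_correct[OF st1 N decides_add X1]]])
      fix Y s2 assume Y: "Y \<in> results es add_guard X"
        and "(entries ''C'' ?m s2 = Y \<and>
            reg s2 ''g'' = (if candidates es add_guard X = {} then reg s1 ''g'' else 1)) \<and>
          agree (regs_of (phase add_test)) (arrs_of (phase add_test)) s1 s2"
      then have Y2: "entries ''C'' ?m s2 = Y" and g2: "reg s2 ''g'' \<noteq> 0 \<longleftrightarrow> candidates es add_guard X \<noteq> {}"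
        and a2: "agree (regs_of (phase add_test)) (arrs_of (phase add_test)) s1 s2"
        unfolding s1 by auto
      have t2: "tracks es Y Ms s2" using tracks_frame[OF t1 a2] Y2 by simp
      then have st2: "stores es s2" unfolding tracks_def by auto
      show "computes (Seq (phase swap_test)
          (Seq (copy ''M'' (Reg ''o'') ''C'')
            (Seq (Assign ''o'' (Plus (Reg ''o'') (Reg ''m''))) (Assign ''k'' (Plus (Reg ''k'') (Num 1))))))
        s2 (phase_cost N + (loop_cost N 1 + 3 + 1) + 1) (\<Union>Z\<in>results es swap_guard Y. {Z}) ?R"
      proof (rule computes_Seq[OF computes_add_frame[OF phase_correct[OF st2 N decides_swap Y2]]])
        fix Z s3 assume Z: "Z \<in> results es swap_guard Y"
          and "(entries ''C'' ?m s3 = Z \<and>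
              reg s3 ''g'' = (if candidates es swap_guard Y = {} then reg s2 ''g'' else 1)) \<and>
            agree (regs_of (phase swap_test)) (arrs_of (phase swap_test)) s2 s3"
        then have Z3: "entries ''C'' ?m s3 = Z"
          and g3: "reg s3 ''g'' \<noteq> 0 \<longleftrightarrow> candidates es add_guard X \<noteq> {} \<or> candidates es swap_guard Y \<noteq> {}"
          and a3: "agree (regs_of (phase swap_test)) (arrs_of (phase swap_test)) s2 s3"
          using g2 by auto
        have t3: "tracks es Z Ms s3" using tracks_frame[OF t2 a3] Z3 by simp
        have "finite X" "finite Y"
          using X results_bounded[OF X Y] finite_subset by blast+
        then have "reg s3 ''g'' \<noteq> 0 \<longleftrightarrow> card X < card Z"
          using g3 card_results[OF _ Y] card_results[OF _ Z] by auto
        then show "computes (Seq (copy ''M'' (Reg ''o'') ''C'')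
            (Seq (Assign ''o'' (Plus (Reg ''o'') (Reg ''m''))) (Assign ''k'' (Plus (Reg ''k'') (Num 1)))))
          s3 (loop_cost N 1 + 3 + 1) {Z} ?R"
          by (intro ensures_computes ensures_mono[OF record_row[OF N t3]]) auto
      qed
    qed
  qed
  moreover have "(\<Union>Y\<in>results es add_guard X. \<Union>Z\<in>results es swap_guard Y. {Z}) =
      (\<Union>Y\<in>results es add_guard X. results es swap_guard Y)" by simp
  ultimately show ?thesis by (simp only:) (erule computes_mono, simp_all add: round_cost_def)
qed

text \<open>
  By induction on the number of edges that the matching can still gain. The outcomes of the loop satisfy the
  same recursion as the runs of Local Search (\<open>local_search_run_unfold\<close>): an outcome is the result of one
  round, followed by an outcome from there if the matching has grown.
\<close>
lemma loop_correct:
  assumes G: "graph_input n es" and N: "length es \<le> N" and s: "tracks es X Ms s"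
  shows "computes (While (Less (Num 0) (Reg ''g'')) search_round) s
    ((if reg s ''g'' = 0 then 0 else (length es + 1 - card X) * (round_cost N + 2)) + 1)
    (if reg s ''g'' = 0 then {[]} else {Ms'. local_search_run (edges_of es) (picked es X) Ms'})
    (\<lambda>Ms' s'. output_run es s' = Ms @ Ms')"
  using s
proof (induction "length es - card X" arbitrary: X Ms s rule: less_induct)
  case less
  let ?m = "length es"
  let ?loop = "While (Less (Num 0) (Reg ''g'')) search_round"
  let ?R = "\<lambda>Ms' s'. output_run es s' = Ms @ Ms'"
  let ?time = "\<lambda>Z. (?m + 1 - card Z) * (round_cost N + 2)"
  have bounded: "Z \<subseteq> {..<?m}" if "tracks es Z Ns s'" for Z Ns s'
    using that unfolding tracks_def entries_def by auto
  have card_le: "card Z \<le> ?m" if "tracks es Z Ns s'" for Z Ns s'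
    using card_mono[OF _ bounded[OF that]] by simp
  show ?case
  proof (cases "reg s ''g'' = 0")
    case True
    have "computes Skip s 0 {[]} ?R"
      using less.prems by (intro ensures_computes ensures_Skip) (simp add: tracks_def)
    then have "computes ?loop s (Suc 0) {[]} ?R" using True by (intro computes_While) auto
    then show ?thesis using True by simp
  next
    case False
    let ?Zs = "\<Union>Y\<in>results es add_guard X. results es swap_guard Y"
    let ?runs = "\<lambda>Z. if card X < card Z then {Ms'. local_search_run (edges_of es) (picked es Z) Ms'} else {[]}"
    have "computes (Seq search_round ?loop) s (round_cost N + (?time X - (round_cost N + 2) + 1) + 1)
        (\<Union>Z\<in>?Zs. (#) (picked es Z) ` ?runs Z) ?R"
    proof (rule computes_Seq[OF round_correct[OF N less.prems]])
      fix Z s' assume Z: "Z \<in> ?Zs"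
        and "tracks es Z (Ms @ [picked es Z]) s' \<and> (reg s' ''g'' \<noteq> 0 \<longleftrightarrow> card X < card Z)"
      then have t: "tracks es Z (Ms @ [picked es Z]) s'" and g: "reg s' ''g'' = 0 \<longleftrightarrow> \<not> card X < card Z"
        by auto
      have "computes ?loop s' ((if reg s' ''g'' = 0 then 0 else ?time Z) + 1) (?runs Z)
          (\<lambda>Ms' s'. output_run es s' = (Ms @ [picked es Z]) @ Ms')"
      proof (cases "card X < card Z")
        case True
        then have "?m - card Z < ?m - card X" using card_le[OF t] by linarith
        from less.hyps[OF this t] show ?thesis using g True by simp
      next
        case False
        have "computes Skip s' 0 {[]} (\<lambda>Ms' s'. output_run es s' = (Ms @ [picked es Z]) @ Ms')"
          using t by (intro ensures_computes ensures_Skip) (simp add: tracks_def)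
        then have "computes ?loop s' (Suc 0) {[]} (\<lambda>Ms' s'. output_run es s' = (Ms @ [picked es Z]) @ Ms')"
          using False g by (intro computes_While) auto
        then show ?thesis using False g by simp
      qed
      then have "computes ?loop s' ((if reg s' ''g'' = 0 then 0 else ?time Z) + 1) ((#) (picked es Z) ` ?runs Z) ?R"
        by (rule computes_image) simp
      then show "computes ?loop s' (?time X - (round_cost N + 2) + 1) ((#) (picked es Z) ` ?runs Z) ?R"
      proof (rule computes_mono)
        have "?time Z \<le> ?time X - (round_cost N + 2)" if "card X < card Z"
        proof -
          have "?m + 1 - card X = Suc (?m - card X)" using card_le[OF less.prems] by simp
          then have "?time X = (round_cost N + 2) + (?m - card X) * (round_cost N + 2)"
            by (simp only: mult_Suc)
          moreover have "?time Z \<le> (?m - card X) * (round_cost N + 2)"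
            using that by (intro mult_le_mono1) simp
          ultimately show ?thesis by linarith
        qed
        then show "(if reg s' ''g'' = 0 then 0 else ?time Z) + 1 \<le> ?time X - (round_cost N + 2) + 1"
          using g by simp
      qed
    qed
    moreover have "round_cost N + 2 \<le> ?time X" using card_le[OF less.prems] by (simp add: Suc_diff_le)
    ultimately have "computes (Seq search_round ?loop) s (?time X) (\<Union>Z\<in>?Zs. (#) (picked es Z) ` ?runs Z) ?R"
      by (elim computes_mono) simp_all
    moreover have "(\<Union>Z\<in>?Zs. (#) (picked es Z) ` ?runs Z) =
        {Ms'. local_search_run (edges_of es) (picked es X) Ms'}"
    proof -
      have X: "X \<subseteq> {..<?m}" using bounded[OF less.prems] .
      have ex_image: "(\<exists>y. y \<in> f ` A \<and> P y) \<longleftrightarrow> (\<exists>x\<in>A. P (f x))"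
        for f :: "nat set \<Rightarrow> nat set set" and A P by blast
      have card_Z: "card (picked es Z) = card Z" if "Z \<in> ?Zs" for Z
      proof -
        obtain Y where "Y \<in> results es add_guard X" "Z \<in> results es swap_guard Y" using \<open>Z \<in> ?Zs\<close> by blast
        then have "Z \<subseteq> {..<?m}" using results_bounded[OF results_bounded[OF X]] by blast
        then show ?thesis by (rule card_picked[OF G])
      qed
      have "Ms' \<in> (#) (picked es Z) ` ?runs Z \<longleftrightarrow>
          (if card (picked es X) < card (picked es Z)
          then \<exists>Ms''. local_search_run (edges_of es) (picked es Z) Ms'' \<and> Ms' = picked es Z # Ms''
          else Ms' = [picked es Z])" if "Z \<in> ?Zs" for Ms' Z
        unfolding card_Z[OF that] card_picked[OF G X] by (cases "card X < card Z") auto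
      then have "Ms' \<in> (\<Union>Z\<in>?Zs. (#) (picked es Z) ` ?runs Z) \<longleftrightarrow> (\<exists>Z\<in>?Zs.
          if card (picked es X) < card (picked es Z)
          then \<exists>Ms''. local_search_run (edges_of es) (picked es Z) Ms'' \<and> Ms' = picked es Z # Ms''
          else Ms' = [picked es Z])" for Ms'
        unfolding UN_iff[of Ms' _ ?Zs] by (rule bex_cong[OF refl])
      moreover have "local_search_run (edges_of es) (picked es X) Ms' \<longleftrightarrow> (\<exists>Z\<in>?Zs.
          if card (picked es X) < card (picked es Z)
          then \<exists>Ms''. local_search_run (edges_of es) (picked es Z) Ms'' \<and> Ms' = picked es Z # Ms''
          else Ms' = [picked es Z])" for Ms'
        unfolding local_search_run_unfold[of _ "picked es X"] iteration_picked[OF G X] ex_image by (rule refl)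
      ultimately show ?thesis by (intro set_eqI) (simp only: mem_Collect_eq)
    qed
    ultimately have "computes ?loop s (Suc (?time X)) {Ms'. local_search_run (edges_of es) (picked es X) Ms'} ?R"
      using False by (intro computes_While) auto
    then show ?thesis using False by simp
  qed
qed

definition program_cost :: "nat \<Rightarrow> nat" where
  "program_cost N = (N + 1) * (round_cost N + 2) + 3"

lemma program_correct:
  assumes G: "graph_input n es" and N: "length es \<le> N"
  shows "computes local_search_program (input_state n es) (program_cost N)
    {Ms. local_search_run (edges_of es) {} Ms} (\<lambda>Ms s. output_run es s = Ms)"
proof -
  let ?s = "set_reg ''g'' 1 (input_state n es)"
  have "tracks es {} [] ?s"
    unfolding tracks_def stores_def entries_def output_run_def input_state_def by simp
  from loop_correct[OF G N this]
  have "computes (While (Less (Num 0) (Reg ''g'')) search_round) ?s ((length es + 1) * (round_cost N + 2) + 1)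
      {Ms. local_search_run (edges_of es) {} Ms} (\<lambda>Ms s. output_run es s = Ms)"
    by (simp add: picked_def)
  then have "computes local_search_program (input_state n es)
      (1 + ((length es + 1) * (round_cost N + 2) + 1) + 1)
      {Ms. local_search_run (edges_of es) {} Ms} (\<lambda>Ms s. output_run es s = Ms)"
    unfolding local_search_program_def
    by (intro ensures_Seq_computes[OF ensures_Assign, where Q = "\<lambda>s. s = ?s"]) auto
  moreover have "(length es + 1) * (round_cost N + 2) \<le> (N + 1) * (round_cost N + 2)"
    using N by (intro mult_le_mono1) simp
  then have "1 + ((length es + 1) * (round_cost N + 2) + 1) + 1 \<le> program_cost N"
    unfolding program_cost_def by linarith
  ultimately show ?thesis by (rule computes_mono) simp
qed

definition polynomial :: "(nat \<Rightarrow> nat) \<Rightarrow> bool" where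
  "polynomial f \<longleftrightarrow> (\<exists>p. \<forall>N. f N = poly p N)"

lemma polynomial_intros:
  "polynomial (\<lambda>N. k)" "polynomial (\<lambda>N. N)"
  "polynomial f \<Longrightarrow> polynomial h \<Longrightarrow> polynomial (\<lambda>N. f N + h N)"
  "polynomial f \<Longrightarrow> polynomial h \<Longrightarrow> polynomial (\<lambda>N. f N * h N)"
proof -
  show "polynomial (\<lambda>N. k)" unfolding polynomial_def by (intro exI[of _ "[:k:]"]) simp
  show "polynomial (\<lambda>N. N)" unfolding polynomial_def by (intro exI[of _ "[:0, 1:]"]) simp
  show "polynomial (\<lambda>N. f N + h N)" if "polynomial f" "polynomial h"
    using that unfolding polynomial_def by (metis poly_add)
  show "polynomial (\<lambda>N. f N * h N)" if "polynomial f" "polynomial h"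
    using that unfolding polynomial_def by (metis poly_mult)
qed

lemma program_cost_polynomial: "polynomial program_cost"
  unfolding program_cost_def round_cost_def phase_cost_def settle_cost_def scan_cost_def try_cost_def
    check_cost_def loop_cost_def
  by (intro polynomial_intros)

theorem local_search_runs_in_polynomial_time: local_search_polynomial_time
proof -
  obtain p where p: "program_cost N = poly p N" for N
    using program_cost_polynomial unfolding polynomial_def by blast
  have "runs_within local_search_program (input_state n es) (poly p (n + length es)) \<and>
      output_run es ` final_states local_search_program (input_state n es) =
        {Ms. local_search_run (edges_of es) {} Ms}" if "graph_input n es" for n es
    using program_correct[OF that, of "n + length es"] unfolding computes_def p by auto
  then show ?thesis unfolding local_search_polynomial_time_def by blast
qed

section \<open>Outputs of Local Search\<close>

text \<open>
  In the last iteration the matching does not grow. Both moves increase its size, so neither of them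
  was possible, and the output is the matching from which that iteration started.
\<close>

lemma local_search_run_last:
  assumes g: "fin_graph V E" and "local_search_run E M Ms" and "induced_matching E M"
  shows "induced_matching E (last Ms) \<and> (\<nexists>M'. add_move E (last Ms) M') \<and> (\<nexists>M'. swap_move E (last Ms) M')"
  using assms(2,3)
proof induction
  case (stop M M')
  have finM: "finite M" using induced_matching_finite[OF g stop.prems] .
  have add: "card M < card M1" if "add_move E M M1" for M1
    using that finM unfolding add_move_def by auto
  have swap: "card M1 < card M2" if "swap_move E M1 M2" "finite M1" for M1 M2
  proof -
    obtain e e' e'' where "e \<in> M1" "e' \<notin> M1" "e'' \<notin> M1" "e' \<noteq> e''" "M2 = (M1 - {e}) \<union> {e', e''}"
      using \<open>swap_move E M1 M2\<close> unfolding swap_move_def by blast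
    moreover from this have "card M1 > 0" using \<open>finite M1\<close> by (auto simp: card_gt_0_iff)
    ultimately show ?thesis using \<open>finite M1\<close> by (simp add: card_insert_if)
  qed
  obtain M1 where M1: "if_possible (add_move E) M M1" "if_possible (swap_move E) M1 M'"
    using stop.hyps(1) unfolding iteration_def by blast
  have le: "card M1 \<le> card M'" if "finite M1"
    using M1(2) swap[OF _ that] unfolding if_possible_def by (auto split: if_splits intro: less_imp_le)
  have no_add: "\<nexists>M'. add_move E M M'"
  proof
    assume "\<exists>M'. add_move E M M'"
    then have "add_move E M M1" using M1(1) unfolding if_possible_def by simp
    moreover from this have "finite M1" using finM unfolding add_move_def by auto
    ultimately show False using add le stop.hyps(2) by fastforce
  qed
  then have "M1 = M" using M1(1) unfolding if_possible_def by simp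
  then have "\<nexists>M'. swap_move E M M'" and "M' = M"
    using M1(2) swap[OF _ finM] stop.hyps(2) unfolding if_possible_def by (auto split: if_splits)
  then show ?case using no_add stop.prems by simp
next
  case (continue M M' Ms)
  have move: "induced_matching E M2"
    if "if_possible R M1 M2" "induced_matching E M1" "\<And>M1 M2. R M1 M2 \<Longrightarrow> induced_matching E M2" for R M1 M2
    using that unfolding if_possible_def by (auto split: if_splits)
  obtain M1 where M1: "if_possible (add_move E) M M1" "if_possible (swap_move E) M1 M'"
    using continue.hyps(1) unfolding iteration_def by blast
  have "induced_matching E M1"
    by (rule move[OF M1(1) continue.prems]) (auto simp: add_move_def)
  then have "induced_matching E M'"
    by (rule move[OF M1(2)]) (auto simp: swap_move_def)
  moreover have "Ms \<noteq> []" using continue.hyps(3) by (auto elim: local_search_run.cases)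
  ultimately show ?case using continue.IH by simp
qed

theorem corollary8:
  fixes d :: nat
  assumes "d \<ge> 3"
  shows "local_search_polynomial_time \<and>
    (\<forall>(V :: 'a set) E M.
       fin_graph V E \<and> regular d V E \<and> C5_free V E \<and> local_search_output E M \<longrightarrow>
       induced_matching E M \<and>
       real (nu_s E) \<le> (3 / 4 * real d - 1 / 8 + 3 / (16 * real d - 8)) * real (card M))"
proof (intro conjI[OF local_search_runs_in_polynomial_time] allI impI)
  fix V :: "'a set" and E M
  assume *: "fin_graph V E \<and> regular d V E \<and> C5_free V E \<and> local_search_output E M"
  then obtain Ms where Ms: "local_search_run E {} Ms" "M = last Ms"
    unfolding local_search_output_def by blast
  have "induced_matching E {}" unfolding induced_matching_def regular_def by simp
  from local_search_run_last[OF _ Ms(1) this] *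
  have M: "induced_matching E M" "\<nexists>M'. add_move E M M'" "\<nexists>M'. swap_move E M M'"
    unfolding Ms(2) by blast+
  then interpret local_optimum V E M d
    using * by unfold_locales blast+
  show "induced_matching E M \<and>
       real (nu_s E) \<le> (3 / 4 * real d - 1 / 8 + 3 / (16 * real d - 8)) * real (card M)"
    using M(1) nu_s_le assms by simp
qed

end
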